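(* Let $\alpha$ be a composition and $\nu>1$ an integer. Then $$\mathcal D_{\alpha^{\mathrm c}}(-\nu,\nu-1)=\mathcal K_\alpha(\nu).$$
   Context: Notation: $[k]=\{1,\dots,k\}$ for $k\ge1$ and $[k]=\emptyset$ for $k\le 0$. A composition is a finite (possibly empty) tuple $\alpha=(\alpha_1,\dots,\alpha_l)$ of positive integers; $\ell(\alpha)=l$, $|\alpha|=\sum\alpha_i$. For $\alpha$ with $|\alpha|=n$, $\mathrm{set}(\alpha)=\{\alpha_1,\alpha_1+\alpha_2,\dots,\alpha_1+\dots+\alpha_{l-1}\}\subseteq[n-1]$; $\mathrm{comp}$ is the inverse bijection from subsets of $[n-1]$ to compositions of $n$; $\alpha^{\mathrm c}=\mathrm{comp}([n-1]\setminus\mathrm{set}(\alpha))$. Write $\beta\succeq\alpha$ if $\beta$ is obtained from $\alpha$ by adding together some adjacent parts. $M_\alpha=\sum_{i_1<\dots<i_l}x_{i_1}^{\alpha_1}\cdots x_{i_l}^{\alpha_l}$ and $L_{\mathrm{comp}(I)}=\sum_{I\subseteq J\subseteq[n-1]}M_{\mathrm{comp}(J)}$ are the monomial and fundamental quasisymmetric functions. For $|\alpha|=n$, $$\mathcal D_\alpha(q,t)=\sum_{\beta\succeq\alpha}q^{\ell(\beta)-n}(-t)^{\ell(\alpha)-\ell(\beta)}M_\beta,$$ and $\mathcal D_\alpha(-\nu,\nu-1)$ is its specialization at $q=-\nu$, $t=\nu-1$. Let $C_\nu$ be a cyclic group of order $\nu$, written additively, and $Q_n(\nu)=\bigoplus_{i\in[n-1]}C_\nu$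 (trivial if $n\le1$). For $I\subseteq[n-1]$, let $\kappa_I(\nu)$ be the indicator function of $\{g\in Q_n(\nu): g_i\ne0\iff i\in I\}$, and let $\mathrm{scf}(\mathcal N_n(\nu))$ be the complex span of these functions. Let $\chi^I(\nu)$ be the sum of all irreducible characters of $Q_n(\nu)$ whose restriction to the $i$-th factor is trivial exactly when $i\in I$, and $\dot\chi^I(\nu)=\chi^I(\nu)/\chi^I(\nu)(\mathbf 0)$; explicitly $\dot\chi^I(\nu)(g)=\prod_{i\in[n-1]\setminus I}\bar r(g_i)$ with $\bar r(0)=1$ and $\bar r(x)=-1/(\nu-1)$ for $x\neq0$. The $\dot\chi^I(\nu)$ form a basis of $\mathrm{scf}(\mathcal N_n(\nu))$, and $\mathrm{ch}_\nu:\mathrm{scf}(\mathcal N_n(\nu))\to\mathrm{QSym}_n$ is the linear isomorphism $\dot\chi^I(\nu)\mapsto L_{\mathrm{comp}(I)}$. Finally $$\mathcal K_\alpha(\nu)=\mathrm{ch}_\nu\left(\frac{\kappa_{\mathrm{set}(\alpha)}(\nu)}{(\nu-1)^{|\mathrm{set}(\alpha)|}}\right).$$ *)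

theory Defs
  imports
    Complex_Main
    "HOL-Library.Function_Algebras"
    "HOL-Library.Indicator_Function"
    "HOL-Library.Poly_Mapping"
    "HOL-Algebra.Product_Groups"
    "HOL-Algebra.Elementary_Groups"
    "Jordan_Normal_Form.VS_Connect"
begin

subsection \<open>Compositions\<close>

definition is_composition :: "nat list \<Rightarrow> bool" where
  "is_composition \<alpha> \<longleftrightarrow> (\<forall>a\<in>set \<alpha>. 0 < a)"

text \<open>For a natural number \<open>n\<close> the set \<open>[n - 1]\<close> is \<open>{1..n - 1}\<close>, which is empty also for
  \<open>n = 0\<close>, where the subtraction truncates.\<close>

definition descent_set :: "nat list \<Rightarrow> nat set" where
  "descent_set \<alpha> = {sum_list (take k \<alpha>) | k. 1 \<le> k \<and> k \<le> length \<alpha> - 1}"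

definition comp_of :: "nat \<Rightarrow> nat set \<Rightarrow> nat list" where
  "comp_of n = the_inv_into {\<alpha>. is_composition \<alpha> \<and> sum_list \<alpha> = n} descent_set"

definition comp_complement :: "nat list \<Rightarrow> nat list" where
  "comp_complement \<alpha> = comp_of (sum_list \<alpha>) ({1..sum_list \<alpha> - 1} - descent_set \<alpha>)"

text \<open>\<open>coarsens \<beta> \<alpha>\<close> means \<open>\<beta> \<succeq> \<alpha>\<close>: cut \<open>\<alpha>\<close> into nonempty blocks of adjacent parts
  and add up each block.\<close>

definition coarsens :: "nat list \<Rightarrow> nat list \<Rightarrow> bool" where
  "coarsens \<beta> \<alpha> \<longleftrightarrow> (\<exists>bs. concat bs = \<alpha> \<and> [] \<notin> set bs \<and> \<beta> = map sum_list bs)"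


subsection \<open>Quasisymmetric functions\<close>

text \<open>A formal power series in the variables \<open>x\<^sub>0, x\<^sub>1, x\<^sub>2, \<dots>\<close> is given by its coefficient
  function; a monomial is the finitely supported function of its exponents. Numbering the
  variables from \<open>0\<close> instead of \<open>1\<close> is immaterial, since only the order of the indices is used.
  Addition of power series is the pointwise one.\<close>

type_synonym power_series = "(nat \<Rightarrow>\<^sub>0 nat) \<Rightarrow> complex"

definition scale_fun :: "complex \<Rightarrow> ('x \<Rightarrow> complex) \<Rightarrow> 'x \<Rightarrow> complex" where
  "scale_fun c f = (\<lambda>x. c * f x)"

text \<open>The coefficient of a monomial \<open>m\<close> in the infinite sum \<open>M\<^sub>\<alpha>\<close> is the number of summands
  that are equal to \<open>m\<close>.\<close>

definition monomial_qsym :: "nat list \<Rightarrow> power_series" where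
  "monomial_qsym \<alpha> m = of_nat (card {is :: nat list. length is = length \<alpha> \<and> sorted_wrt (<) is \<and>
      (\<Sum>j<length \<alpha>. Poly_Mapping.single (is ! j) (\<alpha> ! j)) = m})"

definition fundamental_qsym :: "nat list \<Rightarrow> power_series" where
  "fundamental_qsym \<alpha> =
    (\<Sum>J | descent_set \<alpha> \<subseteq> J \<and> J \<subseteq> {1..sum_list \<alpha> - 1}. monomial_qsym (comp_of (sum_list \<alpha>) J))"

definition qsym_D :: "nat list \<Rightarrow> complex \<Rightarrow> complex \<Rightarrow> power_series" where
  "qsym_D \<alpha> q t =
    (\<Sum>\<beta> | coarsens \<beta> \<alpha>.
      scale_fun (q powi (int (length \<beta>) - int (sum_list \<alpha>)) * (- t) ^ (length \<alpha> - length \<beta>))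
        (monomial_qsym \<beta>))"


subsection \<open>Irreducible complex characters\<close>

definition matrix_representation ::
  "('a, 'b) monoid_scheme \<Rightarrow> nat \<Rightarrow> ('a \<Rightarrow> complex mat) \<Rightarrow> bool" where
  "matrix_representation G d \<rho> \<longleftrightarrow>
    (\<forall>g\<in>carrier G. \<rho> g \<in> carrier_mat d d) \<and> \<rho> \<one>\<^bsub>G\<^esub> = 1\<^sub>m d \<and>
    (\<forall>g\<in>carrier G. \<forall>h\<in>carrier G. \<rho> (g \<otimes>\<^bsub>G\<^esub> h) = \<rho> g * \<rho> h)"

definition irreducible_representation ::
  "('a, 'b) monoid_scheme \<Rightarrow> nat \<Rightarrow> ('a \<Rightarrow> complex mat) \<Rightarrow> bool" where
  "irreducible_representation G d \<rho> \<longleftrightarrow>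
    matrix_representation G d \<rho> \<and> 0 < d \<and>
    (\<forall>W. VectorSpace.subspace class_ring W (module_vec TYPE(complex) d) \<and>
         (\<forall>g\<in>carrier G. \<forall>w\<in>W. \<rho> g *\<^sub>v w \<in> W)
       \<longrightarrow> W = {0\<^sub>v d} \<or> W = carrier_vec d)"

text \<open>Complex functions on a group \<open>G\<close> are extended by \<open>0\<close> outside \<open>carrier G\<close>, so that
  functions that agree on \<open>G\<close> are equal and the pointwise operations respect the convention.\<close>

definition character_of ::
  "('a, 'b) monoid_scheme \<Rightarrow> ('a \<Rightarrow> complex mat) \<Rightarrow> 'a \<Rightarrow> complex" where
  "character_of G \<rho> g = (if g \<in> carrier G then (\<Sum>i<dim_row (\<rho> g). \<rho> g $$ (i, i)) else 0)"

definition irreducible_characters :: "('a, 'b) monoid_scheme \<Rightarrow> ('a \<Rightarrow> complex) set" where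
  "irreducible_characters G = {character_of G \<rho> | d \<rho>. irreducible_representation G d \<rho>}"


subsection \<open>Superclass functions on powers of a cyclic group\<close>

text \<open>Below, \<open>C\<close> is a cyclic group of order \<open>\<nu> = Coset.order C\<close>, written multiplicatively.\<close>

definition Q_group :: "('a, 'b) monoid_scheme \<Rightarrow> nat \<Rightarrow> (nat \<Rightarrow> 'a) monoid" where
  "Q_group C n = sum_group {1..n - 1} (\<lambda>_. C)"

definition factor_embedding ::
  "('a, 'b) monoid_scheme \<Rightarrow> nat \<Rightarrow> nat \<Rightarrow> 'a \<Rightarrow> nat \<Rightarrow> 'a" where
  "factor_embedding C n i x = (\<lambda>j\<in>{1..n - 1}. if j = i then x else \<one>\<^bsub>C\<^esub>)"

definition kappa :: "('a, 'b) monoid_scheme \<Rightarrow> nat \<Rightarrow> nat set \<Rightarrow> (nat \<Rightarrow> 'a) \<Rightarrow> complex" where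
  "kappa C n I =
    indicator {g \<in> carrier (Q_group C n). \<forall>i\<in>{1..n - 1}. g i \<noteq> \<one>\<^bsub>C\<^esub> \<longleftrightarrow> i \<in> I}"

definition scf :: "('a, 'b) monoid_scheme \<Rightarrow> nat \<Rightarrow> ((nat \<Rightarrow> 'a) \<Rightarrow> complex) set" where
  "scf C n = Modules.module.span scale_fun (kappa C n ` Pow {1..n - 1})"

definition chi :: "('a, 'b) monoid_scheme \<Rightarrow> nat \<Rightarrow> nat set \<Rightarrow> (nat \<Rightarrow> 'a) \<Rightarrow> complex" where
  "chi C n I =
    (\<Sum>\<psi> | \<psi> \<in> irreducible_characters (Q_group C n) \<and>
      (\<forall>i\<in>{1..n - 1}. (\<forall>x\<in>carrier C. \<psi> (factor_embedding C n i x) = 1) \<longleftrightarrow> i \<in> I). \<psi>)"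

definition chi_dot :: "('a, 'b) monoid_scheme \<Rightarrow> nat \<Rightarrow> nat set \<Rightarrow> (nat \<Rightarrow> 'a) \<Rightarrow> complex" where
  "chi_dot C n I = (\<lambda>g. chi C n I g / chi C n I \<one>\<^bsub>Q_group C n\<^esub>)"

text \<open>The values of \<open>ch\<close> on the basis of all \<open>chi_dot C n I\<close> determine it on \<open>scf C n\<close>;
  extensionality pins it down outside.\<close>

definition ch ::
  "('a, 'b) monoid_scheme \<Rightarrow> nat \<Rightarrow> ((nat \<Rightarrow> 'a) \<Rightarrow> complex) \<Rightarrow> power_series" where
  "ch C n = (THE \<Phi>.
     \<Phi> \<in> extensional (scf C n) \<and>
     (\<forall>f\<in>scf C n. \<forall>g\<in>scf C n. \<Phi> (f + g) = \<Phi> f + \<Phi> g) \<and>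
     (\<forall>c. \<forall>f\<in>scf C n. \<Phi> (scale_fun c f) = scale_fun c (\<Phi> f)) \<and>
     (\<forall>I. I \<subseteq> {1..n - 1} \<longrightarrow> \<Phi> (chi_dot C n I) = fundamental_qsym (comp_of n I)))"

definition qsym_K :: "('a, 'b) monoid_scheme \<Rightarrow> nat list \<Rightarrow> power_series" where
  "qsym_K C \<alpha> = ch C (sum_list \<alpha>)
     (\<lambda>g. kappa C (sum_list \<alpha>) (descent_set \<alpha>) g / (of_nat (Coset.order C) - 1) ^ card (descent_set \<alpha>))"

end

theory Submission
  imports
    Defs
    "Jordan_Normal_Form.Spectral_Radius"
    "HOL-Algebra.Multiplicative_Group"
begin

text \<open>
  Write \<open>N = {1..n - 1}\<close> and let \<open>J\<close> be the descent set of \<open>\<alpha>\<close>. Everything on the group side is a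
  product over the coordinates \<open>i \<in> N\<close>. The irreducible characters of an abelian group are linear
  (Schur's lemma), those of a power are products of characters of the factors, and the nontrivial
  characters of a cyclic group of order \<open>\<nu>\<close> sum to \<open>\<nu> - 1\<close> at \<open>1\<close> and to \<open>- 1\<close> elsewhere. Hence
  \<open>chi_dot I\<close> is the product of \<open>r (g i)\<close> over \<open>i \<in> N - I\<close>, where \<open>r 1 = 1\<close> and
  \<open>r x = - 1 / (\<nu> - 1)\<close> for \<open>x \<noteq> 1\<close>. In each coordinate the indicators of \<open>x = 1\<close> and \<open>x \<noteq> 1\<close> are
  linear combinations of \<open>1\<close> and \<open>r\<close>; multiplying out gives
  \<open>kappa J / (\<nu> - 1) ^ card J = (\<Sum>I\<subseteq>N. kappa_coeff \<nu> N J I * chi_dot I)\<close> with coefficients that are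
  again products over \<open>N\<close> (\<open>kappa_expansion\<close>). The inverse change of basis shows that the map
  \<open>ch\<close>, a definite description, really is linear and takes the prescribed values
  (\<open>ch_properties\<close>).

  Applying \<open>ch\<close> replaces \<open>chi_dot I\<close> by a fundamental function, that is, by the sum of the monomial
  functions indexed by the sets \<open>B \<supseteq> I\<close>. The coefficient of the monomial function indexed by \<open>B\<close> is
  therefore the sum of \<open>kappa_coeff \<nu> N J I\<close> over all \<open>I \<subseteq> B\<close>, which factorises once more
  (\<open>sum_kappa_coeff_subsets\<close>): it vanishes unless \<open>B\<close> is disjoint from \<open>J\<close>, and otherwise it is a
  power of \<open>- 1 / \<nu>\<close> times a power of \<open>1 - \<nu>\<close>. On the other side, the coarsenings of the complement
  of \<open>\<alpha>\<close> are exactly the compositions whose descent set \<open>B\<close> is contained in \<open>N - J\<close>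
  (\<open>coarsens_iff_descent_set_subset\<close>), and the same powers occur there as coefficients.
\<close>

section \<open>Compositions and their descent sets\<close>

text \<open>Including the total makes the set of partial sums grow by exactly one element, a new
  maximum, whenever a positive part is appended; the descent set is the same set without the total. So
  statements about descent sets become inductions on the last part.\<close>
definition partial_sums :: "nat list \<Rightarrow> nat set" where
  "partial_sums \<alpha> = (\<lambda>k. sum_list (take k \<alpha>)) ` {1..length \<alpha>}"

lemma partial_sums_Nil [simp]: "partial_sums [] = {}"
  by (simp add: partial_sums_def)

lemma partial_sums_snoc [simp]:
  "partial_sums (\<alpha> @ [b]) = insert (sum_list \<alpha> + b) (partial_sums \<alpha>)"
proof -
  have "{1..length (\<alpha> @ [b])} = insert (Suc (length \<alpha>)) {1..length \<alpha>}"
    by auto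
  then show ?thesis
    by (auto simp: partial_sums_def image_iff)
qed

lemma partial_sums_append_subset: "partial_sums \<alpha> \<subseteq> partial_sums (\<alpha> @ \<beta>)"
  by (induction \<beta> rule: rev_induct) (auto simp flip: append_assoc)

lemma finite_partial_sums [simp]: "finite (partial_sums \<alpha>)"
  by (simp add: partial_sums_def)

lemma sum_list_in_partial_sums: "\<alpha> \<noteq> [] \<Longrightarrow> sum_list \<alpha> \<in> partial_sums \<alpha>"
  by (cases \<alpha> rule: rev_cases) auto

lemma partial_sums_le_sum_list: "s \<in> partial_sums \<alpha> \<Longrightarrow> s \<le> sum_list \<alpha>"
  by (induction \<alpha> rule: rev_induct) auto

lemma is_composition_Nil [simp]: "is_composition []"
  by (simp add: is_composition_def)

lemma is_composition_append [simp]: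
  "is_composition (\<alpha> @ \<beta>) \<longleftrightarrow> is_composition \<alpha> \<and> is_composition \<beta>"
  by (auto simp: is_composition_def)

lemma is_composition_singleton [simp]: "is_composition [a] \<longleftrightarrow> 0 < a"
  by (simp add: is_composition_def)

lemma is_composition_sum_list_eq_0: "is_composition \<alpha> \<Longrightarrow> sum_list \<alpha> = 0 \<longleftrightarrow> \<alpha> = []"
  by (cases \<alpha> rule: rev_cases) auto

lemma partial_sums_pos: "is_composition \<alpha> \<Longrightarrow> s \<in> partial_sums \<alpha> \<Longrightarrow> 0 < s"
  by (induction \<alpha> rule: rev_induct) auto

lemma card_partial_sums: "is_composition \<alpha> \<Longrightarrow> card (partial_sums \<alpha>) = length \<alpha>"
proof (induction \<alpha> rule: rev_induct)
  case (snoc b \<alpha>)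
  then have "sum_list \<alpha> + b \<notin> partial_sums \<alpha>"
    using partial_sums_le_sum_list[of "sum_list \<alpha> + b" \<alpha>] by auto
  with snoc show ?case by simp
qed simp

text \<open>The largest partial sum is the total; removing it leaves the partial sums of the composition
  without its last part, so the parts can be read off from the right.\<close>
lemma partial_sums_inject:
  assumes "is_composition \<alpha>" "is_composition \<beta>" "partial_sums \<alpha> = partial_sums \<beta>"
  shows "\<alpha> = \<beta>"
  using assms
proof (induction \<alpha> arbitrary: \<beta> rule: rev_induct)
  case Nil
  then show ?case by (cases \<beta> rule: rev_cases) auto
next
  case (snoc a \<alpha>)
  then obtain \<beta>' b where \<beta>: "\<beta> = \<beta>' @ [b]"
    by (cases \<beta> rule: rev_cases) auto
  have total: "sum_list (\<alpha> @ [a]) = sum_list \<beta>"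
    using snoc.prems(3) \<beta> partial_sums_le_sum_list[of _ "\<alpha> @ [a]"]
      partial_sums_le_sum_list[of _ \<beta>] sum_list_in_partial_sums[of "\<alpha> @ [a]"]
      sum_list_in_partial_sums[of \<beta>]
    by (metis antisym append_is_Nil_conv not_Cons_self2)
  have "sum_list \<alpha> + a \<notin> partial_sums \<alpha>" "sum_list \<beta>' + b \<notin> partial_sums \<beta>'"
    using snoc.prems \<beta> partial_sums_le_sum_list[of "sum_list \<alpha> + a" \<alpha>]
      partial_sums_le_sum_list[of "sum_list \<beta>' + b" \<beta>'] by auto
  then have "partial_sums \<alpha> = partial_sums \<beta>'"
    using snoc.prems(3) total \<beta> by (auto simp: insert_ident)
  then have "\<alpha> = \<beta>'"
    using snoc \<beta> by auto
  then show ?case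
    using total \<beta> by simp
qed

text \<open>The parts are the gaps between consecutive elements of \<open>S\<close>, added in increasing order.\<close>
lemma ex_composition_partial_sums:
  assumes "finite S" "\<And>s. s \<in> S \<Longrightarrow> 0 < s"
  shows "\<exists>\<alpha>. is_composition \<alpha> \<and> partial_sums \<alpha> = S"
  using assms
proof (induction S rule: finite_linorder_max_induct)
  case empty
  show ?case by (rule exI[of _ "[]"]) simp
next
  case (insert b A)
  then obtain \<alpha> where \<alpha>: "is_composition \<alpha>" "partial_sums \<alpha> = A"
    by auto
  have "sum_list \<alpha> < b"
    using insert.hyps(2) insert.prems \<alpha>(2) sum_list_in_partial_sums[of \<alpha>] by (cases "\<alpha> = []") auto
  then show ?case
    using \<alpha> by (intro exI[of _ "\<alpha> @ [b - sum_list \<alpha>]"]) auto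
qed

lemma descent_set_eq_partial_sums_butlast: "descent_set \<alpha> = partial_sums (butlast \<alpha>)"
proof -
  have "take k (butlast \<alpha>) = take k \<alpha>" if "k \<le> length \<alpha> - 1" for k
    using that by (simp add: take_butlast butlast_conv_take min_def)
  then show ?thesis
    by (auto simp: descent_set_def partial_sums_def image_iff) 
qed

lemma descent_set_eq_partial_sums:
  assumes "is_composition \<alpha>"
  shows "descent_set \<alpha> = partial_sums \<alpha> - {sum_list \<alpha>}"
proof (cases \<alpha> rule: rev_cases)
  case (snoc \<beta> b)
  then show ?thesis
    using assms partial_sums_le_sum_list[of "sum_list \<beta> + b" \<beta>]
    by (auto simp: descent_set_eq_partial_sums_butlast)
qed (simp add: descent_set_eq_partial_sums_butlast)

lemma finite_descent_set [simp]: "finite (descent_set \<alpha>)"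
  by (simp add: descent_set_eq_partial_sums_butlast)

lemma descent_set_subset:
  assumes "is_composition \<alpha>"
  shows "descent_set \<alpha> \<subseteq> {1..sum_list \<alpha> - 1}"
  using assms partial_sums_pos[OF assms] partial_sums_le_sum_list[of _ \<alpha>]
  by (fastforce simp: descent_set_eq_partial_sums)

lemma card_descent_set: "is_composition \<alpha> \<Longrightarrow> card (descent_set \<alpha>) = length \<alpha> - 1"
  by (cases \<alpha> rule: rev_cases) (simp_all add: descent_set_eq_partial_sums_butlast card_partial_sums)

lemma bij_betw_descent_set:
  "bij_betw descent_set {\<alpha>. is_composition \<alpha> \<and> sum_list \<alpha> = n} (Pow {1..n - 1})"
proof (cases "n = 0")
  case True
  then have "{\<alpha>. is_composition \<alpha> \<and> sum_list \<alpha> = n} = {[]}"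
    using is_composition_sum_list_eq_0 by auto
  then show ?thesis
    using True by (simp add: bij_betw_def descent_set_eq_partial_sums_butlast)
next
  case False
  have nonempty: "sum_list \<alpha> \<in> partial_sums \<alpha>" if "sum_list \<alpha> = n" for \<alpha>
    using that False by (intro sum_list_in_partial_sums) auto
  show ?thesis
  proof (rule bij_betw_imageI)
    show "inj_on descent_set {\<alpha>. is_composition \<alpha> \<and> sum_list \<alpha> = n}"
    proof (rule inj_onI, clarify)
      fix \<alpha> \<beta> assume *: "is_composition \<alpha>" "is_composition \<beta>" "descent_set \<alpha> = descent_set \<beta>"
        "n = sum_list \<alpha>" "sum_list \<beta> = sum_list \<alpha>"
      then have "partial_sums \<alpha> = partial_sums \<beta>"
        using nonempty[of \<alpha>] nonempty[of \<beta>]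
        by (metis descent_set_eq_partial_sums insert_Diff)
      then show "\<alpha> = \<beta>"
        using * by (intro partial_sums_inject)
    qed
  next
    show "descent_set ` {\<alpha>. is_composition \<alpha> \<and> sum_list \<alpha> = n} = Pow {1..n - 1}" (is "_ ` ?A = _")
    proof (intro equalityI subsetI)
      fix S assume "S \<in> descent_set ` ?A"
      then show "S \<in> Pow {1..n - 1}"
        using descent_set_subset by auto
    next
      fix S assume S: "S \<in> Pow {1..n - 1}"
      then obtain \<alpha> where \<alpha>: "is_composition \<alpha>" "partial_sums \<alpha> = S"
        using ex_composition_partial_sums[of S]
        by (metis PowD atLeastAtMost_iff finite_atLeastAtMost finite_subset not_one_le_zero
            neq0_conv subsetD)
      have "sum_list \<alpha> < n"
        using S \<alpha>(2) False sum_list_in_partial_sums[of \<alpha>] by (cases "\<alpha> = []") fastforce+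
      then have "\<alpha> @ [n - sum_list \<alpha>] \<in> ?A" "descent_set (\<alpha> @ [n - sum_list \<alpha>]) = S"
        using \<alpha> by (auto simp: descent_set_eq_partial_sums_butlast)
      then show "S \<in> descent_set ` ?A"
        by blast
    qed
  qed
qed

lemma
  assumes "I \<subseteq> {1..n - 1}"
  shows is_composition_comp_of: "is_composition (comp_of n I)"
    and sum_list_comp_of: "sum_list (comp_of n I) = n"
    and descent_set_comp_of: "descent_set (comp_of n I) = I"
proof -
  note bij = bij_betw_descent_set[of n, unfolded bij_betw_def]
  have "comp_of n I \<in> {\<alpha>. is_composition \<alpha> \<and> sum_list \<alpha> = n}"
    unfolding comp_of_def using assms bij by (intro the_inv_into_into) auto
  then show "is_composition (comp_of n I)" "sum_list (comp_of n I) = n"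
    by auto
  show "descent_set (comp_of n I) = I"
    unfolding comp_of_def using assms bij by (intro f_the_inv_into_f) auto
qed

lemma comp_of_descent_set: "is_composition \<alpha> \<Longrightarrow> comp_of (sum_list \<alpha>) (descent_set \<alpha>) = \<alpha>"
  unfolding comp_of_def
  using bij_betw_descent_set[of "sum_list \<alpha>"] by (intro the_inv_into_f_f) (auto simp: bij_betw_def)

lemma length_comp_of:
  assumes "I \<subseteq> {1..n - 1}" "0 < n"
  shows "length (comp_of n I) = Suc (card I)"
  using card_descent_set[OF is_composition_comp_of[OF assms(1)]] sum_list_comp_of[OF assms(1)]
    descent_set_comp_of[OF assms(1)] assms(2) by (cases "comp_of n I") auto

lemma sum_list_concat_blocks: "sum_list (concat bs) = (sum_list (map sum_list bs) :: nat)"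
  by (induction bs) simp_all

text \<open>Merging blocks of adjacent parts keeps exactly the partial sums at block ends. The converse
  below cuts \<open>\<alpha>\<close> at those positions where its partial sums are also partial sums of \<open>\<beta>\<close>, splitting
  off the last block first.\<close>
lemma partial_sums_map_sum_list_subset:
  "[] \<notin> set bs \<Longrightarrow> partial_sums (map sum_list bs) \<subseteq> partial_sums (concat bs)"
proof (induction bs rule: rev_induct)
  case (snoc b bs)
  have "sum_list (map sum_list bs) + sum_list b = sum_list (concat bs @ b)"
    by (simp add: sum_list_concat_blocks)
  also have "\<dots> \<in> partial_sums (concat bs @ b)"
    using snoc.prems by (intro sum_list_in_partial_sums) auto
  finally show ?case
    using snoc partial_sums_append_subset[of "concat bs" b] by auto
qed simp

lemma ex_blocks_of_partial_sums_subset: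
  assumes "is_composition \<alpha>" "is_composition \<beta>" "sum_list \<beta> = sum_list \<alpha>"
    "partial_sums \<beta> \<subseteq> partial_sums \<alpha>"
  shows "\<exists>bs. concat bs = \<alpha> \<and> [] \<notin> set bs \<and> \<beta> = map sum_list bs"
  using assms
proof (induction \<beta> arbitrary: \<alpha> rule: rev_induct)
  case Nil
  then have "\<alpha> = []"
    by (metis is_composition_sum_list_eq_0 sum_list.Nil)
  then show ?case
    by (intro exI[of _ "[]"]) simp
next
  case (snoc b \<beta>)
  obtain k where k: "k \<le> length \<alpha>" "sum_list (take k \<alpha>) = sum_list \<beta>"
  proof (cases "\<beta> = []")
    case True
    then show ?thesis using that[of 0] by simp
  next
    case False
    then have "sum_list \<beta> \<in> partial_sums \<alpha>"
      using sum_list_in_partial_sums[of \<beta>] snoc.prems(4) by auto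
    then show ?thesis
      using that by (auto simp: partial_sums_def)
  qed
  have split: "take k \<alpha> @ drop k \<alpha> = \<alpha>"
    by simp
  have comp: "is_composition (take k \<alpha>)" "is_composition (drop k \<alpha>)"
    using snoc.prems(1) is_composition_append[of "take k \<alpha>" "drop k \<alpha>"] by simp_all
  have "sum_list (take k \<alpha>) + sum_list (drop k \<alpha>) = sum_list \<alpha>"
    by (metis split sum_list_append)
  then have last: "sum_list (drop k \<alpha>) = b"
    using snoc.prems(3) k(2) by simp
  have "partial_sums \<beta> \<subseteq> partial_sums (take k \<alpha>)"
  proof
    fix s assume s: "s \<in> partial_sums \<beta>"
    then have "s \<in> partial_sums \<alpha>"
      using snoc.prems(4) by auto
    then obtain j where j: "s = sum_list (take j \<alpha>)" "j \<in> {1..length \<alpha>}"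
      by (auto simp: partial_sums_def)
    show "s \<in> partial_sums (take k \<alpha>)"
    proof (cases "j \<le> k")
      case True
      then show ?thesis
        using j k by (auto simp: partial_sums_def image_iff min_def intro!: bexI[of _ j])
    next
      case False
      (* past position k the partial sums exceed the total of the initial block *)
      have eq: "take j \<alpha> = take k \<alpha> @ take (j - k) (drop k \<alpha>)"
        using False by (metis le_add_diff_inverse nat_le_linear take_add)
      have "is_composition (take (j - k) (drop k \<alpha>))"
        using comp(2) is_composition_append[of "take (j - k) (drop k \<alpha>)" "drop (j - k) (drop k \<alpha>)"]
        by (simp del: drop_drop)
      moreover have "take (j - k) (drop k \<alpha>) \<noteq> []"
        using False j(2) by auto
      ultimately have "sum_list (take (j - k) (drop k \<alpha>)) > 0"
        using is_composition_sum_list_eq_0 by blast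
      then have "s > sum_list \<beta>"
        using j(1) eq k(2) by simp
      then show ?thesis
        using partial_sums_le_sum_list[OF s] by simp
    qed
  qed
  then obtain bs where "concat bs = take k \<alpha>" "[] \<notin> set bs" "\<beta> = map sum_list bs"
    using snoc.IH[of "take k \<alpha>"] comp(1) snoc.prems(2) k(2) by auto
  moreover have "drop k \<alpha> \<noteq> []"
    using last snoc.prems(2) by auto
  ultimately show ?case
    using last by (intro exI[of _ "bs @ [drop k \<alpha>]"]) auto
qed

lemma coarsens_iff_descent_set_subset:
  assumes "is_composition \<alpha>"
  shows "coarsens \<beta> \<alpha> \<longleftrightarrow>
    is_composition \<beta> \<and> sum_list \<beta> = sum_list \<alpha> \<and> descent_set \<beta> \<subseteq> descent_set \<alpha>"
proof
  assume "coarsens \<beta> \<alpha>"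
  then obtain bs where bs: "concat bs = \<alpha>" "[] \<notin> set bs" "\<beta> = map sum_list bs"
    by (auto simp: coarsens_def)
  have "0 < sum_list b" if "b \<in> set bs" for b
  proof -
    have "is_composition b" "b \<noteq> []"
      using that bs(1,2) assms by (auto simp: is_composition_def)
    then show ?thesis
      using is_composition_sum_list_eq_0 by blast
  qed
  then have "is_composition \<beta>"
    using bs(3) by (auto simp: is_composition_def)
  moreover have "sum_list \<beta> = sum_list \<alpha>"
    using bs by (auto simp: sum_list_concat_blocks)
  ultimately show "is_composition \<beta> \<and> sum_list \<beta> = sum_list \<alpha> \<and> descent_set \<beta> \<subseteq> descent_set \<alpha>"
    using partial_sums_map_sum_list_subset[OF bs(2)] bs assms
    by (auto simp: descent_set_eq_partial_sums)
next
  assume *: "is_composition \<beta> \<and> sum_list \<beta> = sum_list \<alpha> \<and> descent_set \<beta> \<subseteq> descent_set \<alpha>"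
  have "partial_sums \<beta> \<subseteq> partial_sums \<alpha>"
  proof (cases "\<alpha> = []")
    case True
    then show ?thesis
      using * is_composition_sum_list_eq_0[of \<beta>] by simp
  next
    case False
    then show ?thesis
      using * assms sum_list_in_partial_sums[of \<alpha>] by (auto simp: descent_set_eq_partial_sums)
  qed
  then show "coarsens \<beta> \<alpha>"
    using ex_blocks_of_partial_sums_subset[of \<alpha> \<beta>] * assms by (auto simp: coarsens_def)
qed

text \<open>Coarsenings of \<open>\<alpha>\<close> are indexed by the subsets \<open>B\<close> of its descent set, and a nonempty
  composition has one part more than it has descents, which gives the exponents.\<close>
lemma qsym_D_eq_sum_Pow:
  assumes "is_composition \<alpha>"
  defines "n \<equiv> sum_list \<alpha>"
  shows "qsym_D \<alpha> q t = (\<Sum>B\<in>Pow (descent_set \<alpha>).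
    scale_fun (q powi (int (card B) - int (n - 1)) * (- t) ^ (card (descent_set \<alpha>) - card B))
      (monomial_qsym (comp_of n B)))"
proof -
  have sub: "B \<subseteq> {1..n - 1}" if "B \<in> Pow (descent_set \<alpha>)" for B
    using that descent_set_subset[OF assms(1)] by (auto simp: n_def)
  have inj: "inj_on (comp_of n) (Pow (descent_set \<alpha>))"
    using descent_set_comp_of sub by (metis inj_onI)
  have image: "{\<beta>. coarsens \<beta> \<alpha>} = comp_of n ` Pow (descent_set \<alpha>)"
  proof (intro equalityI subsetI)
    fix \<beta> assume "\<beta> \<in> {\<beta>. coarsens \<beta> \<alpha>}"
    then show "\<beta> \<in> comp_of n ` Pow (descent_set \<alpha>)"
      using comp_of_descent_set[of \<beta>] coarsens_iff_descent_set_subset[OF assms(1)]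
      by (metis PowI image_eqI mem_Collect_eq n_def)
  next
    fix \<beta> assume "\<beta> \<in> comp_of n ` Pow (descent_set \<alpha>)"
    then obtain B where B: "\<beta> = comp_of n B" "B \<in> Pow (descent_set \<alpha>)"
      by blast
    then show "\<beta> \<in> {\<beta>. coarsens \<beta> \<alpha>}"
      using coarsens_iff_descent_set_subset[OF assms(1)] sub[OF B(2)] is_composition_comp_of[of B n]
        sum_list_comp_of[of B n] descent_set_comp_of[of B n]
      by (auto simp: n_def)
  qed
  (* the empty composition has no part beyond its descents; the truncated n - 1 compensates for it *)
  have exponents: "int (length (comp_of n B)) - int n = int (card B) - int (n - 1)"
      "length \<alpha> - length (comp_of n B) = card (descent_set \<alpha>) - card B"
    if "B \<in> Pow (descent_set \<alpha>)" for B
  proof -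
    have "int (length (comp_of n B)) - int n = int (card B) - int (n - 1) \<and>
      length \<alpha> - length (comp_of n B) = card (descent_set \<alpha>) - card B"
    proof (cases "n = 0")
      case True
      then have "\<alpha> = []" "comp_of n B = []" "B = {}"
        using is_composition_sum_list_eq_0 assms sum_list_comp_of[OF sub[OF that]]
          is_composition_comp_of[OF sub[OF that]] sub[OF that] by auto
      then show ?thesis
        using True by (simp add: descent_set_eq_partial_sums_butlast)
    next
      case False
      then show ?thesis
        using length_comp_of[OF sub[OF that]] card_descent_set[OF assms(1)] by auto
    qed
    then show "int (length (comp_of n B)) - int n = int (card B) - int (n - 1)"
      "length \<alpha> - length (comp_of n B) = card (descent_set \<alpha>) - card B" by auto
  qed
  show ?thesis
    unfolding qsym_D_def image n_def[symmetric] sum.reindex[OF inj]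
    by (intro sum.cong refl) (simp add: exponents)
qed

section \<open>Irreducible characters of abelian groups\<close>

definition linear_characters :: "('a, 'b) monoid_scheme \<Rightarrow> ('a \<Rightarrow> complex) set" where
  "linear_characters G = {\<psi>. \<psi> \<one>\<^bsub>G\<^esub> = 1 \<and> (\<forall>g. g \<notin> carrier G \<longrightarrow> \<psi> g = 0) \<and>
     (\<forall>g\<in>carrier G. \<forall>h\<in>carrier G. \<psi> (g \<otimes>\<^bsub>G\<^esub> h) = \<psi> g * \<psi> h)}"

lemma subspace_vecI:
  fixes W :: "complex vec set"
  assumes "W \<subseteq> carrier_vec d" "0\<^sub>v d \<in> W"
    "\<And>v w. v \<in> W \<Longrightarrow> w \<in> W \<Longrightarrow> v + w \<in> W" "\<And>c v. v \<in> W \<Longrightarrow> c \<cdot>\<^sub>v v \<in> W"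
  shows "VectorSpace.subspace class_ring W (module_vec TYPE(complex) d)"
  using assms vec_vs[of d, where ?'a = complex]
  by (auto simp: VectorSpace.subspace_def LinearCombinations.submodule_def module_vec_simps
      vectorspace_def)

lemma subspace_vec_smult:
  fixes W :: "complex vec set"
  assumes "VectorSpace.subspace class_ring W (module_vec TYPE(complex) d)" "v \<in> W"
  shows "c \<cdot>\<^sub>v v \<in> W"
  using assms
  by (auto simp: VectorSpace.subspace_def LinearCombinations.submodule_def module_vec_simps
      class_ring_simps)

text \<open>Schur's lemma: since the group is abelian, every \<open>\<rho> h\<close> preserves an eigenspace of \<open>\<rho> g\<close>, so
  that eigenspace is the whole space.\<close>
lemma (in comm_group) irreducible_representation_scalar:
  assumes "irreducible_representation G d \<rho>" "g \<in> carrier G"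
  shows "\<exists>c. \<forall>v\<in>carrier_vec d. \<rho> g *\<^sub>v v = c \<cdot>\<^sub>v v"
proof -
  have \<rho>: "\<rho> h \<in> carrier_mat d d" if "h \<in> carrier G" for h
    using assms(1) that by (auto simp: irreducible_representation_def matrix_representation_def)
  have mult: "\<rho> (h \<otimes> k) = \<rho> h * \<rho> k" if "h \<in> carrier G" "k \<in> carrier G" for h k
    using assms(1) that by (auto simp: irreducible_representation_def matrix_representation_def)
  have "0 < d"
    using assms(1) by (auto simp: irreducible_representation_def)
  then obtain c where "eigenvalue (\<rho> g) c"
    using spectrum_non_empty[OF \<rho>[OF assms(2)]] by (auto simp: spectrum_def)
  then obtain v where v: "v \<in> carrier_vec d" "v \<noteq> 0\<^sub>v d" "\<rho> g *\<^sub>v v = c \<cdot>\<^sub>v v"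
    using \<rho>[OF assms(2)] by (auto simp: eigenvalue_def eigenvector_def)
  define W where "W = {v \<in> carrier_vec d. \<rho> g *\<^sub>v v = c \<cdot>\<^sub>v v}"
  have "VectorSpace.subspace class_ring W (module_vec TYPE(complex) d)"
  proof (rule subspace_vecI)
    show "v + w \<in> W" if "v \<in> W" "w \<in> W" for v w
      using that \<rho>[OF assms(2)] by (auto simp: W_def mult_add_distrib_mat_vec smult_add_distrib_vec)
    show "a \<cdot>\<^sub>v v \<in> W" if "v \<in> W" for a v
      using that \<rho>[OF assms(2)] by (auto simp: W_def mult_mat_vec smult_smult_assoc mult.commute)
    show "0\<^sub>v d \<in> W"
      using \<rho>[OF assms(2)] by (auto simp: W_def)
  qed (auto simp: W_def)
  moreover have "\<rho> h *\<^sub>v w \<in> W" if "h \<in> carrier G" "w \<in> W" for h w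
  proof -
    have w: "w \<in> carrier_vec d" "\<rho> g *\<^sub>v w = c \<cdot>\<^sub>v w"
      using that(2) by (auto simp: W_def)
    have "\<rho> g *\<^sub>v (\<rho> h *\<^sub>v w) = (\<rho> g * \<rho> h) *\<^sub>v w"
      using \<rho> that(1) assms(2) w(1) by (subst assoc_mult_mat_vec) auto
    also have "\<rho> g * \<rho> h = \<rho> h * \<rho> g"
      using that(1) assms(2) by (simp add: m_comm flip: mult)
    also have "(\<rho> h * \<rho> g) *\<^sub>v w = \<rho> h *\<^sub>v (\<rho> g *\<^sub>v w)"
      using \<rho> that(1) assms(2) w(1) by (subst assoc_mult_mat_vec) auto
    also have "\<dots> = c \<cdot>\<^sub>v (\<rho> h *\<^sub>v w)"
      using \<rho>[OF that(1)] w by (simp add: mult_mat_vec)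
    finally show ?thesis
      using \<rho>[OF that(1)] w(1) by (auto simp: W_def)
  qed
  ultimately have "W = {0\<^sub>v d} \<or> W = carrier_vec d"
    using assms(1) by (auto simp: irreducible_representation_def)
  moreover have "v \<in> W"
    using v by (simp add: W_def)
  ultimately have "W = carrier_vec d"
    using v(2) by auto
  then show ?thesis
    by (auto simp: W_def)
qed

text \<open>Scalar matrices preserve every subspace, for instance the hyperplane of vectors whose first
  coordinate vanishes; it is proper, and it is nonzero as soon as \<open>d > 1\<close>.\<close>
lemma (in comm_group) irreducible_representation_degree_1:
  assumes "irreducible_representation G d \<rho>"
  shows "d = 1"
proof (rule ccontr)
  assume "d \<noteq> 1"
  moreover have "0 < d"
    using assms by (auto simp: irreducible_representation_def)
  ultimately have "1 < d"
    by simp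
  define W where "W = {v \<in> carrier_vec d. v $ 0 = (0 :: complex)}"
  have "VectorSpace.subspace class_ring W (module_vec TYPE(complex) d)"
    using \<open>0 < d\<close> by (intro subspace_vecI) (auto simp: W_def)
  moreover have "\<rho> g *\<^sub>v w \<in> W" if g: "g \<in> carrier G" and w: "w \<in> W" for g w
  proof -
    obtain c where "\<forall>v\<in>carrier_vec d. \<rho> g *\<^sub>v v = c \<cdot>\<^sub>v v"
      using irreducible_representation_scalar[OF assms g] by blast
    then show ?thesis
      using w \<open>0 < d\<close> by (auto simp: W_def)
  qed
  ultimately have "W = {0\<^sub>v d} \<or> W = carrier_vec d"
    using assms by (auto simp: irreducible_representation_def)
  moreover have "unit_vec d 1 \<in> W" "unit_vec d 1 \<noteq> (0\<^sub>v d :: complex vec)"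
    "unit_vec d 0 \<notin> W"
    using \<open>1 < d\<close> by (auto simp: W_def)
  ultimately show False
    by auto
qed

text \<open>Summing over irreducible characters thus becomes summing over homomorphisms into the
  multiplicative group of complex numbers.\<close>
lemma (in comm_group) irreducible_characters_eq_linear_characters:
  "irreducible_characters G = linear_characters G"
proof (intro equalityI subsetI)
  fix \<psi> assume "\<psi> \<in> irreducible_characters G"
  then obtain d \<rho> where \<rho>: "irreducible_representation G d \<rho>" "\<psi> = character_of G \<rho>"
    by (auto simp: irreducible_characters_def)
  have "matrix_representation G 1 \<rho>"
    using \<rho>(1) irreducible_representation_degree_1[OF \<rho>(1)]
    by (auto simp: irreducible_representation_def)
  then have mat: "\<And>g. g \<in> carrier G \<Longrightarrow> \<rho> g \<in> carrier_mat 1 1" "\<rho> \<one> = 1\<^sub>m 1"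
    "\<And>g h. g \<in> carrier G \<Longrightarrow> h \<in> carrier G \<Longrightarrow> \<rho> (g \<otimes> h) = \<rho> g * \<rho> h"
    by (auto simp: matrix_representation_def)
  have \<psi>: "\<psi> g = (if g \<in> carrier G then \<rho> g $$ (0, 0) else 0)" for g
    using mat(1)[of g] by (auto simp: \<rho>(2) character_of_def)
  show "\<psi> \<in> linear_characters G"
    unfolding linear_characters_def
  proof (intro CollectI conjI ballI allI impI)
    fix g h assume gh: "g \<in> carrier G" "h \<in> carrier G"
    then show "\<psi> (g \<otimes> h) = \<psi> g * \<psi> h"
      using mat(1)[OF gh(1)] mat(1)[OF gh(2)] by (auto simp: \<psi> mat(3) scalar_prod_def)
  qed (auto simp: \<psi> mat(2))
next
  fix \<psi> assume "\<psi> \<in> linear_characters G"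
  then have \<psi>: "\<psi> \<one> = 1" "\<And>g. g \<notin> carrier G \<Longrightarrow> \<psi> g = 0"
    "\<And>g h. g \<in> carrier G \<Longrightarrow> h \<in> carrier G \<Longrightarrow> \<psi> (g \<otimes> h) = \<psi> g * \<psi> h"
    by (auto simp: linear_characters_def)
  define \<rho> where "\<rho> g = mat 1 1 (\<lambda>_. \<psi> g)" for g
  have "matrix_representation G 1 \<rho>"
    by (auto simp: matrix_representation_def \<rho>_def \<psi> scalar_prod_def intro!: eq_matI)
  moreover have "W = {0\<^sub>v 1} \<or> W = carrier_vec 1"
    if W: "VectorSpace.subspace class_ring W (module_vec TYPE(complex) 1)" for W
  proof (rule disjCI)
    assume "W \<noteq> carrier_vec 1"
    have sub: "W \<subseteq> carrier_vec 1" "0\<^sub>v 1 \<in> W"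
      using W by (auto simp: VectorSpace.subspace_def LinearCombinations.submodule_def
          module_vec_simps)
    have "w = 0\<^sub>v 1" if w: "w \<in> W" for w
    proof (rule ccontr)
      assume "w \<noteq> 0\<^sub>v 1"
      then have "w $ 0 \<noteq> 0"
        using w sub(1) by (auto simp: vec_eq_iff)
      have "v \<in> W" if "v \<in> carrier_vec 1" for v
      proof -
        have "(v $ 0 / w $ 0) \<cdot>\<^sub>v w = v"
          using that w sub(1) \<open>w $ 0 \<noteq> 0\<close> by (auto simp: vec_eq_iff)
        then show ?thesis
          using subspace_vec_smult[OF W w, of "v $ 0 / w $ 0"] by simp
      qed
      then show False
        using \<open>W \<noteq> carrier_vec 1\<close> sub(1) by auto
    qed
    then show "W = {0\<^sub>v 1}"
      using sub(2) by blast
  qed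
  ultimately have "irreducible_representation G 1 \<rho>"
    by (auto simp: irreducible_representation_def)
  moreover have "\<psi> = character_of G \<rho>"
    by (auto simp: character_of_def \<rho>_def \<psi>(2))
  ultimately show "\<psi> \<in> irreducible_characters G"
    by (auto simp: irreducible_characters_def)
qed

section \<open>Linear characters of a cyclic group and of its powers\<close>

lemma linear_character_one: "\<psi> \<in> linear_characters G \<Longrightarrow> \<psi> \<one>\<^bsub>G\<^esub> = 1"
  by (simp add: linear_characters_def)

lemma linear_character_outside: "\<psi> \<in> linear_characters G \<Longrightarrow> g \<notin> carrier G \<Longrightarrow> \<psi> g = 0"
  by (simp add: linear_characters_def)

lemma linear_character_mult:
  "\<psi> \<in> linear_characters G \<Longrightarrow> g \<in> carrier G \<Longrightarrow> h \<in> carrier G \<Longrightarrow>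
    \<psi> (g \<otimes>\<^bsub>G\<^esub> h) = \<psi> g * \<psi> h"
  by (simp add: linear_characters_def)

lemma (in group) linear_character_pow:
  assumes "\<psi> \<in> linear_characters G" "a \<in> carrier G"
  shows "\<psi> (a [^] (k :: nat)) = \<psi> a ^ k"
  using assms
  by (induction k) (auto simp: linear_character_one linear_character_mult)

lemma sum_roots_unity_power:
  assumes "0 < n"
  shows "(\<Sum>z | z ^ n = 1. (z :: complex) ^ k) = (if n dvd k then of_nat n else 0)"
proof (cases "n dvd k")
  case True
  then obtain m where "k = n * m" ..
  then have "z ^ k = 1" if "z ^ n = 1" for z :: complex
    using that by (simp add: power_mult)
  then show ?thesis
    using True assms by (simp add: card_roots_unity_eq)
next
  case False
  define \<omega> where "\<omega> = cis (2 * pi / of_nat n)"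
  have \<omega>_pow: "\<omega> ^ j = cis (2 * pi * real j / real n)" for j
    by (simp add: \<omega>_def DeMoivre mult_ac)
  have \<omega>: "\<omega> ^ n = 1" "\<omega> \<noteq> 0"
    using assms by (simp add: \<omega>_pow) (simp add: \<omega>_def)
  have "\<omega> ^ k = (\<omega> ^ n) ^ (k div n) * \<omega> ^ (k mod n)"
    by (simp flip: power_mult power_add)
  then have "\<omega> ^ k = \<omega> ^ (k mod n)"
    using \<omega> by simp
  moreover have "\<omega> ^ (k mod n) \<noteq> \<omega> ^ 0"
    using inj_onD[OF bij_betw_imp_inj_on[OF bij_betw_roots_unity[OF assms]], of "k mod n" 0] False
      assms by (auto simp: \<omega>_pow mod_greater_zero_iff_not_dvd)
  ultimately have "\<omega> ^ k \<noteq> 1"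
    by simp
  (* multiplication by the primitive root \<omega> permutes the roots of unity, and it multiplies the sum by \<omega> ^ k *)
  have "bij_betw ((*) \<omega>) {z. z ^ n = 1} {z. z ^ n = 1}"
    using \<omega> assms by (intro bij_betw_byWitness[where f' = "\<lambda>z. z / \<omega>"])
      (auto simp: power_mult_distrib power_divide)
  then have "(\<Sum>z | z ^ n = 1. z ^ k) = (\<Sum>z | z ^ n = 1. (\<omega> * z) ^ k)"
    by (intro sum.reindex_bij_betw[symmetric])
  also have "\<dots> = \<omega> ^ k * (\<Sum>z | z ^ n = 1. z ^ k)"
    by (simp add: power_mult_distrib sum_distrib_left)
  finally show ?thesis
    using \<open>\<omega> ^ k \<noteq> 1\<close> False by simp
qed

text \<open>A linear character of a cyclic group is determined by its value at a generator \<open>a\<close>, and this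
  value can be any root of unity of the group order, because \<open>a [^] j = a [^] k\<close> only if \<open>j\<close> and \<open>k\<close>
  are congruent modulo that order.\<close>
lemma (in group) linear_characters_of_cyclic:
  assumes "a \<in> carrier G" "subgroup_generated G {a} = G" "0 < Coset.order G"
  shows "bij_betw (\<lambda>\<psi>. \<psi> a) (linear_characters G) {z. z ^ Coset.order G = 1}"
    and "carrier G = range (\<lambda>k :: nat. a [^] k)"
    and "a [^] (k :: nat) = \<one> \<longleftrightarrow> Coset.order G dvd k"
proof -
  have ord: "ord a = Coset.order G"
    using cyclic_order_is_ord[OF assms(1)] assms(2) by simp
  show pow_one: "a [^] k = \<one> \<longleftrightarrow> Coset.order G dvd k" for k :: nat
    using pow_eq_id[OF assms(1)] ord by simp
  show carrier: "carrier G = range (\<lambda>k :: nat. a [^] k)"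
  proof
    have "x \<in> range (\<lambda>k :: nat. a [^] k)" if "x \<in> carrier G" for x
    proof -
      have "x \<in> range (\<lambda>k :: int. a [^] k)"
        using that carrier_subgroup_generated_by_singleton[OF assms(1)] assms(2) by simp
      then obtain k :: int where k: "x = a [^] k"
        by auto
      have "k = int (nat (k mod int (Coset.order G))) + int (Coset.order G) * (k div int (Coset.order G))"
        using assms(3) by simp
      then have "x = a [^] (int (nat (k mod int (Coset.order G))) + int (Coset.order G) * (k div int (Coset.order G)))"
        using k by simp
      also have "\<dots> = a [^] (nat (k mod int (Coset.order G))) \<otimes> (a [^] Coset.order G) [^] (k div int (Coset.order G))"
        using assms(1) by (simp add: int_pow_mult int_pow_int flip: int_pow_pow)
      also have "\<dots> = a [^] (nat (k mod int (Coset.order G)))"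
        using assms(1) pow_one[of "Coset.order G"] by simp
      finally show ?thesis
        by blast
    qed
    then show "carrier G \<subseteq> range (\<lambda>k :: nat. a [^] k)"
      by blast
  qed (use assms(1) in auto)
  have same_power: "z ^ j = z ^ k" if "z ^ Coset.order G = 1" "a [^] j = a [^] k"
    for z :: complex and j k :: nat
  proof -
    have *: "z ^ j = z ^ k" if "j \<le> k" "a [^] j = a [^] k" for j k :: nat
    proof -
      have "a [^] (k - j) = \<one>"
        using pow_eq_div2[OF assms(1)] that by metis
      then obtain m where "k - j = Coset.order G * m"
        using pow_one by auto
      then have "k = j + Coset.order G * m"
        using that(1) by simp
      then show ?thesis
        using \<open>z ^ Coset.order G = 1\<close> by (simp add: power_add power_mult)
    qed
    show ?thesis
      using *[OF _ that(2)] *[OF _ that(2)[symmetric]] by (metis nat_le_linear)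
  qed
  show "bij_betw (\<lambda>\<psi>. \<psi> a) (linear_characters G) {z. z ^ Coset.order G = 1}"
  proof (rule bij_betw_imageI)
    show "inj_on (\<lambda>\<psi>. \<psi> a) (linear_characters G)"
    proof (rule inj_onI, rule ext)
      fix \<psi> \<phi> x assume *: "\<psi> \<in> linear_characters G" "\<phi> \<in> linear_characters G" "\<psi> a = \<phi> a"
      then show "\<psi> x = \<phi> x"
        using carrier assms(1)
        by (cases "x \<in> carrier G") (auto simp: linear_character_pow linear_character_outside)
    qed
    show "(\<lambda>\<psi>. \<psi> a) ` linear_characters G = {z. z ^ Coset.order G = 1}"
    proof (intro equalityI subsetI)
      fix z assume "z \<in> (\<lambda>\<psi>. \<psi> a) ` linear_characters G"
      then show "z \<in> {z. z ^ Coset.order G = 1}"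
        using linear_character_pow[OF _ assms(1), symmetric] pow_one[of "Coset.order G"]
          linear_character_one by auto
    next
      fix z :: complex assume z: "z \<in> {z. z ^ Coset.order G = 1}"
      define \<psi> where "\<psi> x = (if x \<in> carrier G then z ^ (SOME k. a [^] (k :: nat) = x) else 0)" for x
      have \<psi>_pow: "\<psi> (a [^] k) = z ^ k" for k :: nat
      proof -
        have "a [^] (SOME j. a [^] (j :: nat) = a [^] k) = a [^] k"
          by (rule someI[where x = k]) simp
        then show ?thesis
          using same_power[of z "SOME j. a [^] (j :: nat) = a [^] k" k] z assms(1)
          by (simp add: \<psi>_def)
      qed
      have "\<psi> \<one> = 1"
        using \<psi>_pow[of 0] by simp
      moreover have "\<psi> (a [^] j \<otimes> a [^] k) = \<psi> (a [^] j) * \<psi> (a [^] k)" for j k :: nat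
        using assms(1) by (simp add: nat_pow_mult \<psi>_pow power_add)
      ultimately have "\<psi> \<in> linear_characters G"
        by (auto simp: linear_characters_def carrier \<psi>_def)
      moreover have "\<psi> a = z"
        using \<psi>_pow[of 1] assms(1) by simp
      ultimately show "z \<in> (\<lambda>\<psi>. \<psi> a) ` linear_characters G"
        by auto
    qed
  qed
qed

lemma (in group)
  assumes "cyclic_group G" "0 < Coset.order G"
  shows finite_linear_characters_cyclic: "finite (linear_characters G)"
    and sum_linear_characters_cyclic: "x \<in> carrier G \<Longrightarrow>
      (\<Sum>\<psi>\<in>linear_characters G. \<psi> x) = (if x = \<one> then of_nat (Coset.order G) else 0)"
proof -
  obtain a where a: "a \<in> carrier G" "subgroup_generated G {a} = G"
    using assms(1) by (auto simp: cyclic_group_def)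
  note cyclic = linear_characters_of_cyclic[OF a assms(2)]
  show "finite (linear_characters G)"
    using bij_betw_finite[OF cyclic(1)] assms(2) by (simp add: finite_roots_unity)
  show "(\<Sum>\<psi>\<in>linear_characters G. \<psi> x) = (if x = \<one> then of_nat (Coset.order G) else 0)"
    if x: "x \<in> carrier G"
  proof -
    obtain k :: nat where k: "x = a [^] k"
      using x cyclic(2) by auto
    have "(\<Sum>\<psi>\<in>linear_characters G. \<psi> x) = (\<Sum>\<psi>\<in>linear_characters G. \<psi> a ^ k)"
      using a(1) by (simp add: k linear_character_pow)
    also have "\<dots> = (\<Sum>z | z ^ Coset.order G = 1. z ^ k)"
      by (rule sum.reindex_bij_betw[OF cyclic(1)])
    finally show ?thesis
      using sum_roots_unity_power[OF assms(2)] cyclic(3) by (simp add: k)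
  qed
qed

lemma (in group) indicator_carrier_linear_character: "indicator (carrier G) \<in> linear_characters G"
  by (simp add: linear_characters_def)

lemma Q_group_simps:
  assumes "group C"
  shows carrier_Q_group: "carrier (Q_group C n) = PiE {1..n - 1} (\<lambda>_. carrier C)"
    and one_Q_group: "\<one>\<^bsub>Q_group C n\<^esub> = (\<lambda>i\<in>{1..n - 1}. \<one>\<^bsub>C\<^esub>)"
    and mult_Q_group: "g \<otimes>\<^bsub>Q_group C n\<^esub> h = (\<lambda>i\<in>{1..n - 1}. g i \<otimes>\<^bsub>C\<^esub> h i)"
  using assms by (auto simp: Q_group_def carrier_sum_group)

lemma comm_group_Q_group:
  assumes "comm_group C"
  shows "comm_group (Q_group C n)"
proof -
  interpret comm_group C by fact
  have "group (Q_group C n)"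
    by (simp add: Q_group_def)
  then show ?thesis
    by (rule group.group_comm_groupI)
      (auto simp: Q_group_simps[OF is_group] m_comm PiE_iff intro!: restrict_ext)
qed

definition product_character ::
  "('a, 'b) monoid_scheme \<Rightarrow> nat \<Rightarrow> (nat \<Rightarrow> 'a \<Rightarrow> complex) \<Rightarrow> (nat \<Rightarrow> 'a) \<Rightarrow> complex" where
  "product_character C n \<phi> g =
    (if g \<in> carrier (Q_group C n) then \<Prod>i\<in>{1..n - 1}. \<phi> i (g i) else 0)"

lemma (in group) factor_embedding_carrier:
  "x \<in> carrier G \<Longrightarrow> factor_embedding G n i x \<in> carrier (Q_group G n)"
  by (auto simp: factor_embedding_def carrier_Q_group is_group)

lemma (in group) product_character_factor_embedding:
  assumes "\<phi> \<in> PiE {1..n - 1} (\<lambda>_. linear_characters G)" "i \<in> {1..n - 1}" "x \<in> carrier G"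
  shows "product_character G n \<phi> (factor_embedding G n i x) = \<phi> i x"
proof -
  have "\<phi> j (factor_embedding G n i x j) = (if j = i then \<phi> i x else 1)" if "j \<in> {1..n - 1}" for j
    using that assms(1) by (auto simp: factor_embedding_def PiE_iff linear_character_one)
  then have "product_character G n \<phi> (factor_embedding G n i x) =
    (\<Prod>j\<in>{1..n - 1}. if j = i then \<phi> i x else 1)"
    using factor_embedding_carrier[OF assms(3)] by (simp add: product_character_def)
  then show ?thesis
    using assms(2) by simp
qed

text \<open>The factors are recovered by restricting to the embedded copies of the group; conversely a
  character of the power is the product of these restrictions, since every element is the product
  of its components.\<close>
lemma (in group) bij_betw_product_character:
  "bij_betw (product_character G n)
    (PiE {1..n - 1} (\<lambda>_. linear_characters G)) (linear_characters (Q_group G n))"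
proof (rule bij_betw_imageI)
  note Q = Q_group_simps[OF is_group]
  let ?N = "{1..n - 1}"
  let ?\<Phi> = "PiE ?N (\<lambda>_. linear_characters G)"
  show "inj_on (product_character G n) ?\<Phi>"
  proof (rule inj_onI, rule PiE_ext)
    fix \<phi> \<psi> i assume *: "\<phi> \<in> ?\<Phi>" "\<psi> \<in> ?\<Phi>" "product_character G n \<phi> = product_character G n \<psi>"
      and i: "i \<in> ?N"
    show "\<phi> i = \<psi> i"
    proof
      fix x
      have "\<phi> i \<in> linear_characters G" "\<psi> i \<in> linear_characters G"
        using * i by (auto simp: PiE_iff)
      then show "\<phi> i x = \<psi> i x"
        using product_character_factor_embedding[OF *(1) i, of x]
          product_character_factor_embedding[OF *(2) i, of x] *(3)
        by (cases "x \<in> carrier G") (auto simp: linear_character_outside)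
    qed
  qed
  show "product_character G n ` ?\<Phi> = linear_characters (Q_group G n)"
  proof (intro equalityI subsetI)
    fix \<psi> assume "\<psi> \<in> product_character G n ` ?\<Phi>"
    then obtain \<phi> where \<phi>: "\<phi> \<in> ?\<Phi>" "\<psi> = product_character G n \<phi>"
      by blast
    then have \<phi>_linear: "\<phi> i \<in> linear_characters G" if "i \<in> ?N" for i
      using that by (auto simp: PiE_iff)
    have "\<psi> \<one>\<^bsub>Q_group G n\<^esub> = 1"
      by (simp add: \<phi>(2) product_character_def Q linear_character_one \<phi>_linear)
    moreover have "\<psi> (g \<otimes>\<^bsub>Q_group G n\<^esub> h) = \<psi> g * \<psi> h"
      if "g \<in> carrier (Q_group G n)" "h \<in> carrier (Q_group G n)" for g h
    proof -
      have "g \<otimes>\<^bsub>Q_group G n\<^esub> h \<in> carrier (Q_group G n)"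
        using that by (auto simp: Q)
      moreover have "\<phi> i ((g \<otimes>\<^bsub>Q_group G n\<^esub> h) i) = \<phi> i (g i) * \<phi> i (h i)" if "i \<in> ?N" for i
        using that \<open>g \<in> _\<close> \<open>h \<in> _\<close>
        by (auto simp: Q PiE_iff linear_character_mult[OF \<phi>_linear])
      ultimately show ?thesis
        using that by (simp add: \<phi>(2) product_character_def prod.distrib)
    qed
    ultimately show "\<psi> \<in> linear_characters (Q_group G n)"
      by (simp add: linear_characters_def \<phi>(2) product_character_def)
  next
    fix \<psi> assume \<psi>: "\<psi> \<in> linear_characters (Q_group G n)"
    define \<phi> where "\<phi> = (\<lambda>i\<in>?N. \<lambda>x. if x \<in> carrier G then \<psi> (factor_embedding G n i x) else 0)"
    have emb_mult: "factor_embedding G n i (x \<otimes> y) =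
        factor_embedding G n i x \<otimes>\<^bsub>Q_group G n\<^esub> factor_embedding G n i y"
      if "x \<in> carrier G" "y \<in> carrier G" for i x y
      using that by (auto simp: factor_embedding_def Q intro!: restrict_ext)
    have emb_one: "factor_embedding G n i \<one> = \<one>\<^bsub>Q_group G n\<^esub>" for i
      by (auto simp: factor_embedding_def Q intro!: restrict_ext)
    have "\<phi> \<in> ?\<Phi>"
      by (auto simp: \<phi>_def linear_characters_def[of G] emb_mult emb_one
          linear_character_one[OF \<psi>] linear_character_mult[OF \<psi>] factor_embedding_carrier)
    moreover have "\<psi> = product_character G n \<phi>"
    proof
      fix g
      show "\<psi> g = product_character G n \<phi> g"
      proof (cases "g \<in> carrier (Q_group G n)")
        case True
        then have g: "g \<in> PiE ?N (\<lambda>_. carrier G)"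
          by (simp add: Q)
        (* g is the product of its components, reached by adding one coordinate at a time *)
        have "\<psi> (\<lambda>j\<in>?N. if j \<in> S then g j else \<one>) = (\<Prod>i\<in>S. \<psi> (factor_embedding G n i (g i)))"
          if "S \<subseteq> ?N" for S
          using finite_subset[OF that finite_atLeastAtMost] that
        proof (induction S rule: finite_induct)
          case empty
          then show ?case
            using linear_character_one[OF \<psi>] by (simp add: Q restrict_def)
        next
          case (insert i S)
          let ?h = "\<lambda>j\<in>?N. if j \<in> S then g j else \<one>"
          have gi: "g j \<in> carrier G" if "j \<in> ?N" for j
            using g that by auto
          have "(\<lambda>j\<in>?N. if j \<in> insert i S then g j else \<one>) =
              factor_embedding G n i (g i) \<otimes>\<^bsub>Q_group G n\<^esub> ?h"
            using insert.hyps gi by (auto simp: factor_embedding_def Q intro!: restrict_ext)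
          moreover have "?h \<in> carrier (Q_group G n)"
            using gi by (auto simp: Q)
          ultimately have "\<psi> (\<lambda>j\<in>?N. if j \<in> insert i S then g j else \<one>) =
              \<psi> (factor_embedding G n i (g i)) * \<psi> ?h"
            using insert.prems gi by (simp add: linear_character_mult[OF \<psi>] factor_embedding_carrier)
          moreover have "\<psi> ?h = (\<Prod>j\<in>S. \<psi> (factor_embedding G n j (g j)))"
            using insert by blast
          ultimately show ?case
            using insert.hyps by (simp only: prod.insert not_False_eq_True)
        qed
        from this[of ?N] have "\<psi> (\<lambda>j\<in>?N. if j \<in> ?N then g j else \<one>) =
            (\<Prod>i\<in>?N. \<psi> (factor_embedding G n i (g i)))" by simp
        moreover have "(\<lambda>j\<in>?N. if j \<in> ?N then g j else \<one>) = g"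
          using g by (auto simp: PiE_iff extensional_def)
        moreover have "(\<Prod>i\<in>?N. \<psi> (factor_embedding G n i (g i))) = (\<Prod>i\<in>?N. \<phi> i (g i))"
          using g by (intro prod.cong) (auto simp: \<phi>_def PiE_iff)
        ultimately show ?thesis
          using True by (simp add: product_character_def)
      next
        case False
        then show ?thesis
          by (simp add: product_character_def linear_character_outside[OF \<psi>])
      qed
    qed
    ultimately show "\<psi> \<in> product_character G n ` ?\<Phi>"
      by blast
  qed
qed

section \<open>Superclass functions as products over the coordinates\<close>

lemma sum_fun_apply: "(\<Sum>a\<in>A. f a) x = (\<Sum>a\<in>A. f a x)"
  by (induction A rule: infinite_finite_induct) auto

text \<open>The expansion of a product of binary sums, in the form in which all sums over subsets of the
  coordinates are evaluated below: a summand that factorises over the coordinates gives a sum that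
  factorises.\<close>
lemma sum_Pow_prod_if:
  fixes f h :: "'i \<Rightarrow> 'c :: comm_semiring_1"
  assumes "finite N"
  shows "(\<Sum>I\<in>Pow N. \<Prod>i\<in>N. if i \<in> I then f i else h i) = (\<Prod>i\<in>N. f i + h i)"
proof -
  have "(\<Prod>i\<in>N. if i \<in> I then f i else h i) = prod f I * prod h (N - I)" if "I \<in> Pow N" for I
  proof -
    have "N \<inter> {i. i \<in> I} = I" "N \<inter> - {i. i \<in> I} = N - I"
      using that by auto
    then show ?thesis
      using assms by (simp add: prod.If_cases)
  qed
  then show ?thesis
    using assms by (simp add: prod_add)
qed

lemma prod_if_const:
  fixes c :: "'c :: comm_monoid_mult"
  assumes "finite N" "J \<subseteq> N"
  shows "(\<Prod>i\<in>N. if i \<in> J then c else 1) = c ^ card J"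
proof -
  have "N \<inter> {i. i \<in> J} = J"
    using assms by auto
  then show ?thesis
    using assms by (simp add: prod.If_cases)
qed

lemma prod_indicator_eq:
  assumes "finite N"
  shows "(\<Prod>i\<in>N. if P i then 1 else 0 :: 'c :: {comm_semiring_1, semiring_no_zero_divisors}) =
    (if \<forall>i\<in>N. P i then 1 else 0)"
proof (cases "\<forall>i\<in>N. P i")
  case False
  then show ?thesis
    using assms by (auto intro!: prod_zero)
qed simp

lemma (in group) trivial_character_iff:
  assumes "\<phi> \<in> linear_characters G"
  shows "(\<forall>x\<in>carrier G. \<phi> x = 1) \<longleftrightarrow> \<phi> = indicator (carrier G)"
proof
  assume *: "\<forall>x\<in>carrier G. \<phi> x = 1"
  show "\<phi> = indicator (carrier G)"
  proof
    show "\<phi> x = indicator (carrier G) x" for x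
      using * linear_character_outside[OF assms] by (cases "x \<in> carrier G") auto
  qed
qed simp

text \<open>All characters together sum to the regular character; the trivial one contributes \<open>1\<close>.\<close>
lemma (in group) sum_nontrivial_linear_characters:
  assumes "cyclic_group G" "0 < Coset.order G" "x \<in> carrier G"
  shows "(\<Sum>\<psi>\<in>linear_characters G - {indicator (carrier G)}. \<psi> x) =
    (if x = \<one> then of_nat (Coset.order G) - 1 else - 1)"
  using assms sum_linear_characters_cyclic[OF assms] finite_linear_characters_cyclic[OF assms(1,2)]
  by (simp add: sum_diff1 indicator_carrier_linear_character)

text \<open>The condition defining \<open>chi\<close> constrains each factor separately, so the characters that satisfy
  it form a product set and their sum is a product of sums.\<close>
lemma (in group) characters_trivial_on_factors:
  assumes "cyclic_group G"
  shows "{\<psi> \<in> irreducible_characters (Q_group G n).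
      \<forall>i\<in>{1..n - 1}. (\<forall>x\<in>carrier G. \<psi> (factor_embedding G n i x) = 1) \<longleftrightarrow> i \<in> I} =
    product_character G n ` PiE {1..n - 1} (\<lambda>i. if i \<in> I then {indicator (carrier G)}
      else linear_characters G - {indicator (carrier G)})" (is "?A = _ ` PiE ?N ?S")
proof -
  let ?X = "PiE ?N (\<lambda>_. linear_characters G)"
  let ?P = "\<lambda>\<psi>. \<forall>i\<in>?N. (\<forall>x\<in>carrier G. \<psi> (factor_embedding G n i x) = 1) \<longleftrightarrow> i \<in> I"
  have "comm_group (Q_group G n)"
    using comm_group_Q_group cyclic_imp_abelian_group[OF assms] by blast
  then have "irreducible_characters (Q_group G n) = product_character G n ` ?X"
    using comm_group.irreducible_characters_eq_linear_characters
      bij_betw_imp_surj_on[OF bij_betw_product_character] by blast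
  then have "?A = product_character G n ` {\<phi> \<in> ?X. ?P (product_character G n \<phi>)}"
    by auto
  also have "{\<phi> \<in> ?X. ?P (product_character G n \<phi>)} =
      {\<phi> \<in> ?X. \<forall>i\<in>?N. \<phi> i = indicator (carrier G) \<longleftrightarrow> i \<in> I}"
    using product_character_factor_embedding trivial_character_iff by (auto simp: PiE_iff)
  also have "\<dots> = PiE ?N ?S"
  proof (rule Set.set_eqI)
    fix \<phi> :: "nat \<Rightarrow> 'a \<Rightarrow> complex"
    have "\<phi> i \<in> ?S i \<longleftrightarrow> \<phi> i \<in> linear_characters G \<and> (\<phi> i = indicator (carrier G) \<longleftrightarrow> i \<in> I)" for i
      using indicator_carrier_linear_character by simp metis
    then show "\<phi> \<in> {\<phi> \<in> ?X. \<forall>i\<in>?N. \<phi> i = indicator (carrier G) \<longleftrightarrow> i \<in> I} \<longleftrightarrow> \<phi> \<in> PiE ?N ?S"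
      by (simp only: mem_Collect_eq PiE_iff) blast
  qed
  finally show ?thesis .
qed

lemma (in group) chi_eq_prod:
  assumes "cyclic_group G" "0 < Coset.order G"
  shows "chi G n I g = (if g \<in> carrier (Q_group G n)
    then \<Prod>i\<in>{1..n - 1}. if i \<in> I then 1 else if g i = \<one> then of_nat (Coset.order G) - 1 else - 1
    else 0)"
proof -
  let ?N = "{1..n - 1}"
  let ?T = "indicator (carrier G) :: 'a \<Rightarrow> complex"
  let ?S = "\<lambda>i. if i \<in> I then {?T} else linear_characters G - {?T}"
  have inj: "inj_on (product_character G n) (PiE ?N ?S)"
    using indicator_carrier_linear_character
    by (intro inj_on_subset[OF bij_betw_imp_inj_on[OF bij_betw_product_character]] PiE_mono) auto
  have "chi G n I g = (\<Sum>\<phi>\<in>PiE ?N ?S. product_character G n \<phi> g)"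
    unfolding chi_def characters_trivial_on_factors[OF assms(1)] sum.reindex[OF inj]
    by (simp add: sum_fun_apply)
  also have "\<dots> = (if g \<in> carrier (Q_group G n)
    then \<Prod>i\<in>?N. if i \<in> I then 1 else if g i = \<one> then of_nat (Coset.order G) - 1 else - 1 else 0)"
  proof (cases "g \<in> carrier (Q_group G n)")
    case True
    then have g: "g i \<in> carrier G" if "i \<in> ?N" for i
      using that by (auto simp: carrier_Q_group is_group)
    have "(\<Sum>\<phi>\<in>PiE ?N ?S. product_character G n \<phi> g) = (\<Sum>\<phi>\<in>PiE ?N ?S. \<Prod>i\<in>?N. \<phi> i (g i))"
      using True by (simp add: product_character_def)
    also have "\<dots> = (\<Prod>i\<in>?N. \<Sum>\<phi>\<in>?S i. \<phi> (g i))"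
      using finite_linear_characters_cyclic[OF assms] by (subst prod_sum_PiE) auto
    also have "\<dots> = (\<Prod>i\<in>?N. if i \<in> I then 1 else
        if g i = \<one> then of_nat (Coset.order G) - 1 else - 1)"
      using g sum_nontrivial_linear_characters[OF assms] by (intro prod.cong) auto
    finally show ?thesis
      using True by simp
  qed (simp add: product_character_def)
  finally show ?thesis .
qed

lemma (in group) chi_dot_eq_prod:
  assumes "cyclic_group G" "1 < Coset.order G"
  shows "chi_dot G n I g = (if g \<in> carrier (Q_group G n)
    then \<Prod>i\<in>{1..n - 1}. if i \<in> I \<or> g i = \<one> then 1 else - 1 / (of_nat (Coset.order G) - 1) else 0)"
proof (cases "g \<in> carrier (Q_group G n)")
  case True
  have one: "\<one>\<^bsub>Q_group G n\<^esub> \<in> carrier (Q_group G n)"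
    using is_group by (auto simp: Q_group_simps)
  have "chi G n I \<one>\<^bsub>Q_group G n\<^esub> = (\<Prod>i\<in>{1..n - 1}. if i \<in> I then 1
      else if \<one>\<^bsub>Q_group G n\<^esub> i = \<one> then of_nat (Coset.order G) - 1 else - 1)"
    using assms one by (simp add: chi_eq_prod)
  also have "\<dots> = (\<Prod>i\<in>{1..n - 1}. if i \<in> I then 1 else of_nat (Coset.order G) - 1)"
    by (intro prod.cong refl) (simp add: one_Q_group is_group)
  finally have "chi G n I \<one>\<^bsub>Q_group G n\<^esub> =
      (\<Prod>i\<in>{1..n - 1}. if i \<in> I then 1 else of_nat (Coset.order G) - 1)" .
  moreover have "chi G n I g =
      (\<Prod>i\<in>{1..n - 1}. if i \<in> I then 1 else if g i = \<one> then of_nat (Coset.order G) - 1 else - 1)"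
    using True assms by (simp add: chi_eq_prod)
  ultimately have "chi_dot G n I g = (\<Prod>i\<in>{1..n - 1}.
      (if i \<in> I then 1 else if g i = \<one> then of_nat (Coset.order G) - 1 else - 1) /
      (if i \<in> I then 1 else of_nat (Coset.order G) - 1))"
    by (simp only: chi_dot_def prod_dividef)
  also have "\<dots> = (\<Prod>i\<in>{1..n - 1}. if i \<in> I \<or> g i = \<one> then 1 else - 1 / (of_nat (Coset.order G) - 1))"
    using assms(2) by (intro prod.cong refl) auto
  finally show ?thesis
    using True by simp
qed (use assms in \<open>simp add: chi_dot_def chi_eq_prod\<close>)

lemma (in group) kappa_eq_prod:
  assumes "J \<subseteq> {1..n - 1}"
  shows "kappa G n J g = (if g \<in> carrier (Q_group G n)
    then \<Prod>i\<in>{1..n - 1}. if i \<in> J then (if g i \<noteq> \<one> then 1 else 0) else (if g i = \<one> then 1 else 0)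
    else 0)"
proof -
  have "(\<Prod>i\<in>{1..n - 1}. if i \<in> J then (if g i \<noteq> \<one> then 1 else 0) else (if g i = \<one> then 1 else 0)) =
    (\<Prod>i\<in>{1..n - 1}. if g i \<noteq> \<one> \<longleftrightarrow> i \<in> J then 1 else 0 :: complex)"
    by (intro prod.cong) auto
  then show ?thesis
    by (auto simp: kappa_def prod_indicator_eq indicator_def simp del: One_nat_def)
qed

text \<open>The coefficients of \<open>kappa J / (\<nu> - 1) ^ card J\<close> in terms of the \<open>chi_dot I\<close>. To the product
  \<open>chi_dot I\<close> a coordinate outside \<open>I\<close> contributes the function \<open>r\<close> with \<open>r 1 = 1\<close> and \<open>r x = - 1 / (\<nu> - 1)\<close> for \<open>x \<noteq> 1\<close>, and a
  coordinate in \<open>I\<close> contributes \<open>1\<close>. The factors are the coefficients in the identities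
  \<open>[x \<noteq> 1] / (\<nu> - 1) = 1 / \<nu> - r x / \<nu>\<close>, used on \<open>J\<close>, and
  \<open>[x = 1] = 1 / \<nu> + (\<nu> - 1) / \<nu> * r x\<close>, used outside \<open>J\<close>.\<close>
definition kappa_coeff :: "complex \<Rightarrow> nat set \<Rightarrow> nat set \<Rightarrow> nat set \<Rightarrow> complex" where
  "kappa_coeff \<nu> N J I = (\<Prod>i\<in>N. if i \<in> I then 1 / \<nu> else if i \<in> J then - 1 / \<nu> else (\<nu> - 1) / \<nu>)"

lemma (in group) kappa_expansion:
  assumes "cyclic_group G" "1 < Coset.order G" "J \<subseteq> {1..n - 1}"
  defines "\<nu> \<equiv> of_nat (Coset.order G) :: complex"
  shows "kappa G n J g / (\<nu> - 1) ^ card J =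
    (\<Sum>I\<in>Pow {1..n - 1}. kappa_coeff \<nu> {1..n - 1} J I * chi_dot G n I g)"
proof (cases "g \<in> carrier (Q_group G n)")
  case True
  let ?N = "{1..n - 1}"
  have \<nu>: "\<nu> \<noteq> 0" "\<nu> \<noteq> 1"
    using assms(2) by (auto simp: \<nu>_def)
  have "(\<Sum>I\<in>Pow ?N. kappa_coeff \<nu> ?N J I * chi_dot G n I g) =
    (\<Sum>I\<in>Pow ?N. \<Prod>i\<in>?N. if i \<in> I then 1 / \<nu> else
      (if i \<in> J then - 1 / \<nu> else (\<nu> - 1) / \<nu>) * (if g i = \<one> then 1 else - 1 / (\<nu> - 1)))"
    unfolding kappa_coeff_def chi_dot_eq_prod[OF assms(1,2)] \<nu>_def[symmetric] if_P[OF True]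
      prod.distrib[symmetric]
    by (intro sum.cong prod.cong refl) simp
  also have "\<dots> = (\<Prod>i\<in>?N. 1 / \<nu> +
      (if i \<in> J then - 1 / \<nu> else (\<nu> - 1) / \<nu>) * (if g i = \<one> then 1 else - 1 / (\<nu> - 1)))"
    by (rule sum_Pow_prod_if) simp
  also have "\<dots> = (\<Prod>i\<in>?N. (if i \<in> J then (if g i \<noteq> \<one> then 1 else 0) else (if g i = \<one> then 1 else 0)) /
      (if i \<in> J then \<nu> - 1 else 1))"
    using \<nu> by (intro prod.cong refl) (auto simp: divide_simps)
  also have "\<dots> = kappa G n J g / (\<nu> - 1) ^ card J"
    using True assms(3) by (simp only: prod_dividef prod_if_const kappa_eq_prod finite_atLeastAtMost if_True)
  finally show ?thesis ..
qed (use assms in \<open>simp add: kappa_eq_prod chi_dot_eq_prod\<close>)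

text \<open>The coefficients of \<open>chi_dot I\<close> in terms of the \<open>kappa J\<close>, which are simply the values of
  \<open>chi_dot I\<close> at elements with support \<open>J\<close>.\<close>
definition chi_dot_coeff :: "complex \<Rightarrow> nat set \<Rightarrow> nat set \<Rightarrow> nat set \<Rightarrow> complex" where
  "chi_dot_coeff \<nu> N I J = (\<Prod>i\<in>N. if i \<in> J \<and> i \<notin> I then - 1 / (\<nu> - 1) else 1)"

lemma (in group) chi_dot_expansion:
  assumes "cyclic_group G" "1 < Coset.order G"
  shows "chi_dot G n I g =
    (\<Sum>J\<in>Pow {1..n - 1}. chi_dot_coeff (of_nat (Coset.order G)) {1..n - 1} I J * kappa G n J g)"
proof (cases "g \<in> carrier (Q_group G n)")
  case True
  let ?N = "{1..n - 1}" and ?\<nu> = "of_nat (Coset.order G) :: complex"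
  have "(\<Sum>J\<in>Pow ?N. chi_dot_coeff ?\<nu> ?N I J * kappa G n J g) =
    (\<Sum>J\<in>Pow ?N. \<Prod>i\<in>?N. if i \<in> J
      then (if i \<in> I then 1 else - 1 / (?\<nu> - 1)) * (if g i \<noteq> \<one> then 1 else 0)
      else if g i = \<one> then 1 else 0)"
  proof (rule sum.cong[OF refl])
    fix J assume "J \<in> Pow ?N"
    then show "chi_dot_coeff ?\<nu> ?N I J * kappa G n J g = (\<Prod>i\<in>?N. if i \<in> J
      then (if i \<in> I then 1 else - 1 / (?\<nu> - 1)) * (if g i \<noteq> \<one> then 1 else 0)
      else if g i = \<one> then 1 else 0)"
      unfolding chi_dot_coeff_def kappa_eq_prod[OF PowD[OF \<open>J \<in> Pow ?N\<close>]] if_P[OF True]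
        prod.distrib[symmetric]
      by (intro prod.cong refl) simp
  qed
  also have "\<dots> = (\<Prod>i\<in>?N.
      (if i \<in> I then 1 else - 1 / (?\<nu> - 1)) * (if g i \<noteq> \<one> then 1 else 0) + (if g i = \<one> then 1 else 0))"
    by (rule sum_Pow_prod_if) simp
  also have "\<dots> = chi_dot G n I g"
    using True assms by (simp add: chi_dot_eq_prod) (intro prod.cong, auto)
  finally show ?thesis ..
qed (use assms in \<open>simp add: kappa_eq_prod chi_dot_eq_prod\<close>)

text \<open>The two changes of basis are inverse to each other. In each coordinate this is a product of
  two-by-two matrices, and the factor at \<open>i\<close> is \<open>1\<close> or \<open>0\<close> according to whether \<open>I\<close> and \<open>I'\<close> agree
  at \<open>i\<close>.\<close>
lemma chi_dot_coeff_kappa_coeff_inverse: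
  assumes "finite N" "I \<subseteq> N" "I' \<subseteq> N" "\<nu> \<noteq> 0" "\<nu> \<noteq> 1"
  shows "(\<Sum>J\<in>Pow N. chi_dot_coeff \<nu> N I J * (\<nu> - 1) ^ card J * kappa_coeff \<nu> N J I') =
    (if I = I' then 1 else 0)"
proof -
  have "chi_dot_coeff \<nu> N I J * (\<nu> - 1) ^ card J * kappa_coeff \<nu> N J I' =
    (\<Prod>i\<in>N. if i \<in> J
      then (if i \<in> I then 1 else - 1 / (\<nu> - 1)) * (\<nu> - 1) * (if i \<in> I' then 1 / \<nu> else - 1 / \<nu>)
      else if i \<in> I' then 1 / \<nu> else (\<nu> - 1) / \<nu>)" if "J \<in> Pow N" for J
    unfolding chi_dot_coeff_def kappa_coeff_def prod_if_const[OF assms(1) PowD[OF that], symmetric]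
      prod.distrib[symmetric]
    by (intro prod.cong refl) simp
  then have "(\<Sum>J\<in>Pow N. chi_dot_coeff \<nu> N I J * (\<nu> - 1) ^ card J * kappa_coeff \<nu> N J I') =
    (\<Prod>i\<in>N. (if i \<in> I then 1 else - 1 / (\<nu> - 1)) * (\<nu> - 1) * (if i \<in> I' then 1 / \<nu> else - 1 / \<nu>) +
      (if i \<in> I' then 1 / \<nu> else (\<nu> - 1) / \<nu>))"
    using assms(1) by (simp add: sum_Pow_prod_if)
  also have "\<dots> = (\<Prod>i\<in>N. if i \<in> I \<longleftrightarrow> i \<in> I' then 1 else 0)"
    using assms(4,5) by (intro prod.cong refl) (auto simp: divide_simps)
  also have "\<dots> = (if I = I' then 1 else 0)"
    using assms(1-3) by (auto simp: prod_indicator_eq)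
  finally show ?thesis .
qed

text \<open>This sum will be the coefficient of the monomial function indexed by \<open>B\<close>. A coordinate in
  \<open>B\<close> contributes \<open>1 / \<nu> - 1 / \<nu> = 0\<close> if it lies in \<open>J\<close> and \<open>1 / \<nu> + (\<nu> - 1) / \<nu> = 1\<close> otherwise;
  this is why only the sets \<open>B\<close> disjoint from \<open>J\<close> survive. A coordinate outside \<open>B\<close> always
  contributes \<open>- 1 / \<nu>\<close>, times \<open>1 - \<nu>\<close> if it is also outside \<open>J\<close>.\<close>
lemma sum_kappa_coeff_subsets:
  assumes "finite N" "J \<subseteq> N" "B \<subseteq> N" "\<nu> \<noteq> 0"
  shows "(\<Sum>I\<in>Pow N. kappa_coeff \<nu> N J I * (if I \<subseteq> B then 1 else 0)) =
    (if B \<subseteq> N - J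
     then (- \<nu>) powi (int (card B) - int (card N)) * (1 - \<nu>) ^ (card (N - J) - card B) else 0)"
proof -
  have "kappa_coeff \<nu> N J I * (if I \<subseteq> B then 1 else 0) =
    (\<Prod>i\<in>N. if i \<in> I then (if i \<in> B then 1 / \<nu> else 0) else if i \<in> J then - 1 / \<nu> else (\<nu> - 1) / \<nu>)"
    if "I \<in> Pow N" for I
  proof -
    have "(if I \<subseteq> B then 1 else 0) = (\<Prod>i\<in>N. if i \<in> I \<longrightarrow> i \<in> B then 1 else 0 :: complex)"
      using that assms(1) by (auto simp: prod_indicator_eq)
    then show ?thesis
      unfolding kappa_coeff_def by (simp only: prod.distrib[symmetric]) (intro prod.cong refl, simp)
  qed
  then have sum_eq: "(\<Sum>I\<in>Pow N. kappa_coeff \<nu> N J I * (if I \<subseteq> B then 1 else 0)) =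
    (\<Prod>i\<in>N. (if i \<in> B then 1 / \<nu> else 0) + (if i \<in> J then - 1 / \<nu> else (\<nu> - 1) / \<nu>))"
    using assms(1) by (simp add: sum_Pow_prod_if)
  show ?thesis
  proof (cases "B \<subseteq> N - J")
    case True
    have "(\<Prod>i\<in>N. (if i \<in> B then 1 / \<nu> else 0) + (if i \<in> J then - 1 / \<nu> else (\<nu> - 1) / \<nu>)) =
      (\<Prod>i\<in>N. (if i \<in> N - B then inverse (- \<nu>) else 1) * (if i \<in> N - J - B then 1 - \<nu> else 1))"
      using True assms(4) by (intro prod.cong refl) (auto simp: field_simps)
    also have "\<dots> = inverse (- \<nu>) ^ card (N - B) * (1 - \<nu>) ^ card (N - J - B)"
      using assms(1) by (simp only: prod.distrib prod_if_const Diff_subset) (subst prod_if_const, auto)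
    also have "card (N - J - B) = card (N - J) - card B"
      using True assms(1) by (intro card_Diff_subset) (auto intro: finite_subset)
    also have "inverse (- \<nu>) ^ card (N - B) = (- \<nu>) powi (int (card B) - int (card N))"
    proof -
      have "int (card B) - int (card N) = - int (card (N - B))"
        using assms(1,3) card_mono[OF assms(1,3)]
        by (simp add: card_Diff_subset finite_subset)
      then show ?thesis
        by (simp only: power_int_minus power_int_of_nat power_inverse)
    qed
    finally show ?thesis
      using True sum_eq by simp
  next
    case False
    then obtain i where i: "i \<in> N" "i \<in> B" "i \<in> J"
      using assms(3) by auto
    then have "(\<Prod>i\<in>N. (if i \<in> B then 1 / \<nu> else 0) + (if i \<in> J then - 1 / \<nu> else (\<nu> - 1) / \<nu>)) = 0"
      using assms(1) by (intro prod_zero) (auto intro!: bexI[of _ i])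
    then show ?thesis
      using False sum_eq by simp
  qed
qed


section \<open>The characteristic map\<close>

interpretation complex_functions: Modules.module "scale_fun :: complex \<Rightarrow> ('x \<Rightarrow> complex) \<Rightarrow> 'x \<Rightarrow> complex"
  by unfold_locales (auto simp: scale_fun_def algebra_simps fun_eq_iff)

definition linear_on_functions ::
  "('x \<Rightarrow> complex) set \<Rightarrow> (('x \<Rightarrow> complex) \<Rightarrow> 'y \<Rightarrow> complex) \<Rightarrow> bool" where
  "linear_on_functions V \<Phi> \<longleftrightarrow>
    (\<forall>f\<in>V. \<forall>g\<in>V. \<Phi> (f + g) = \<Phi> f + \<Phi> g) \<and> (\<forall>c. \<forall>f\<in>V. \<Phi> (scale_fun c f) = scale_fun c (\<Phi> f))"

lemma linear_on_functions_sum: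
  assumes "complex_functions.subspace V" "linear_on_functions V \<Phi>" "\<And>i. i \<in> A \<Longrightarrow> f i \<in> V"
  shows "\<Phi> (\<Sum>i\<in>A. scale_fun (c i) (f i)) = (\<Sum>i\<in>A. scale_fun (c i) (\<Phi> (f i)))"
proof -
  have "\<Phi> 0 = \<Phi> (scale_fun 0 0)"
    by (simp add: scale_fun_def zero_fun_def)
  also have "\<dots> = scale_fun 0 (\<Phi> 0)"
    using assms(2) complex_functions.subspace_0[OF assms(1)]
    unfolding linear_on_functions_def by blast
  finally have zero: "\<Phi> 0 = 0"
    by simp
  show ?thesis
    using assms(3)
  proof (induction A rule: infinite_finite_induct)
    case (insert i A)
    have "scale_fun (c i) (f i) \<in> V" "(\<Sum>i\<in>A. scale_fun (c i) (f i)) \<in> V"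
      using assms(1) insert.prems
      by (auto intro!: complex_functions.subspace_scale complex_functions.subspace_sum)
    then have "\<Phi> (scale_fun (c i) (f i) + (\<Sum>i\<in>A. scale_fun (c i) (f i))) =
        \<Phi> (scale_fun (c i) (f i)) + \<Phi> (\<Sum>i\<in>A. scale_fun (c i) (f i))"
      using assms(2) unfolding linear_on_functions_def by blast
    moreover have "\<Phi> (scale_fun (c i) (f i)) = scale_fun (c i) (\<Phi> (f i))"
      using assms(2) insert.prems unfolding linear_on_functions_def by blast
    moreover have "\<Phi> (\<Sum>i\<in>A. scale_fun (c i) (f i)) = (\<Sum>i\<in>A. scale_fun (c i) (\<Phi> (f i)))"
      using insert by blast
    ultimately show ?case
      by (simp only: sum.insert[OF insert.hyps])
  qed (auto simp: zero)
qed

text \<open>The functions \<open>kappa J\<close> are indicators of disjoint nonempty sets (nonempty because the group has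
  an element besides \<open>1\<close>), so the coefficients of a superclass function are its values at
  representatives \<open>r J\<close>. This gives linear coordinates on \<open>scf\<close>.\<close>
lemma (in group) scf_expansion:
  assumes "1 < Coset.order G"
  obtains r where "\<And>f. f \<in> scf G n \<Longrightarrow> f = (\<Sum>J\<in>Pow {1..n - 1}. scale_fun (f (r J)) (kappa G n J))"
    and "\<And>J J'. J \<in> Pow {1..n - 1} \<Longrightarrow> J' \<in> Pow {1..n - 1} \<Longrightarrow>
      kappa G n J (r J') = (if J = J' then 1 else 0)"
proof -
  let ?N = "{1..n - 1}"
  have "carrier G \<noteq> {\<one>}"
    using assms by (auto simp: Coset.order_def)
  then obtain x where x: "x \<in> carrier G" "x \<noteq> \<one>"
    by blast
  define r where "r J = (\<lambda>i\<in>?N. if i \<in> J then x else \<one>)" for J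
  have kappa_r: "kappa G n J (r J') = (if J = J' then 1 else 0)"
    if "J \<in> Pow ?N" "J' \<in> Pow ?N" for J J'
  proof -
    have "r J' \<in> carrier (Q_group G n)"
      using x by (auto simp: r_def carrier_Q_group is_group)
    moreover have "(\<forall>i\<in>?N. r J' i \<noteq> \<one> \<longleftrightarrow> i \<in> J) \<longleftrightarrow> J = J'"
      using that x by (auto simp: r_def split: if_splits)
    ultimately show ?thesis
      by (simp add: kappa_def indicator_def)
  qed
  have "f = (\<Sum>J\<in>Pow ?N. scale_fun (f (r J)) (kappa G n J))" if "f \<in> scf G n" for f
    using that unfolding scf_def
  proof (induction rule: complex_functions.span_induct)
    case base
    let ?e = "\<lambda>f. \<Sum>J\<in>Pow ?N. scale_fun (f (r J)) (kappa G n J)"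
    have e_zero: "?e 0 = 0" and e_add: "?e (f + g) = ?e f + ?e g"
      and e_scale: "?e (scale_fun c f) = scale_fun c (?e f)" for f g c
      by (simp_all add: fun_eq_iff scale_fun_def sum_fun_apply algebra_simps sum.distrib sum_distrib_left)
    show ?case
    proof (rule complex_functions.subspaceI; unfold mem_Collect_eq)
      fix f g assume "f = ?e f" "g = ?e g"
      then show "f + g = ?e (f + g)"
        unfolding e_add by (rule arg_cong2)
    next
      fix c f assume "f = ?e f"
      then show "scale_fun c f = ?e (scale_fun c f)"
        unfolding e_scale by (rule arg_cong)
    qed (rule e_zero[symmetric])
  next
    case (step f)
    then obtain J where J: "f = kappa G n J" "J \<in> Pow ?N"
      by blast
    have "(\<Sum>J'\<in>Pow ?N. scale_fun (f (r J')) (kappa G n J')) =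
        (\<Sum>J'\<in>Pow ?N. if J' = J then kappa G n J' else 0)"
      using J kappa_r by (intro sum.cong refl) (auto simp: scale_fun_def zero_fun_def)
    then show ?case
      using J by simp
  qed
  then show thesis
    using kappa_r that by blast
qed

lemma subspace_scf: "complex_functions.subspace (scf C n)"
  by (simp add: scf_def)

lemma (in group) chi_dot_in_scf:
  assumes "cyclic_group G" "1 < Coset.order G"
  shows "chi_dot G n I \<in> scf G n"
proof -
  have "chi_dot G n I = (\<Sum>J\<in>Pow {1..n - 1}.
      scale_fun (chi_dot_coeff (of_nat (Coset.order G)) {1..n - 1} I J) (kappa G n J))"
    by (rule ext) (simp add: chi_dot_expansion[OF assms] sum_fun_apply scale_fun_def)
  also have "\<dots> \<in> scf G n"
    unfolding scf_def
    by (intro complex_functions.span_sum complex_functions.span_scale complex_functions.span_base) auto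
  finally show ?thesis .
qed

lemma (in group) scf_spanned_by_chi_dot:
  assumes "cyclic_group G" "1 < Coset.order G" "f \<in> scf G n"
  shows "\<exists>c. f = (\<Sum>I\<in>Pow {1..n - 1}. scale_fun (c I) (chi_dot G n I))"
proof -
  let ?N = "{1..n - 1}" and ?\<nu> = "of_nat (Coset.order G) :: complex"
  obtain r where r: "f = (\<Sum>J\<in>Pow ?N. scale_fun (f (r J)) (kappa G n J))"
    using scf_expansion[OF assms(2)] assms(3) by metis
  have kappa: "kappa G n J g =
      (\<Sum>I\<in>Pow ?N. (?\<nu> - 1) ^ card J * kappa_coeff ?\<nu> ?N J I * chi_dot G n I g)"
    if "J \<in> Pow ?N" for J g
    using kappa_expansion[OF assms(1,2) PowD[OF that], of g] assms(2)
    by (simp add: divide_simps sum_distrib_left sum_distrib_right mult_ac)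
  define c where "c I = (\<Sum>J\<in>Pow ?N. f (r J) * ((?\<nu> - 1) ^ card J * kappa_coeff ?\<nu> ?N J I))" for I
  have "f g = (\<Sum>I\<in>Pow ?N. scale_fun (c I) (chi_dot G n I)) g" for g
  proof -
    have "f g = (\<Sum>J\<in>Pow ?N. f (r J) * kappa G n J g)"
      using fun_cong[OF r, of g] by (simp add: sum_fun_apply scale_fun_def)
    also have "\<dots> = (\<Sum>J\<in>Pow ?N. \<Sum>I\<in>Pow ?N.
        f (r J) * ((?\<nu> - 1) ^ card J * kappa_coeff ?\<nu> ?N J I) * chi_dot G n I g)"
      by (intro sum.cong refl) (simp add: kappa sum_distrib_left mult_ac)
    also have "\<dots> = (\<Sum>I\<in>Pow ?N. \<Sum>J\<in>Pow ?N.
        f (r J) * ((?\<nu> - 1) ^ card J * kappa_coeff ?\<nu> ?N J I) * chi_dot G n I g)"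
      by (rule sum.swap)
    also have "\<dots> = (\<Sum>I\<in>Pow ?N. scale_fun (c I) (chi_dot G n I)) g"
      by (simp add: c_def sum_fun_apply scale_fun_def sum_distrib_right)
    finally show ?thesis .
  qed
  then show ?thesis
    by blast
qed

text \<open>Existence: the map \<open>F\<close> reads off the coordinates of \<open>f\<close> with respect to the \<open>kappa J\<close> and replaces
  each \<open>chi_dot I\<close> in the expansion of \<open>kappa J\<close> by the fundamental function; the inversion of the
  two changes of basis shows that it takes the prescribed values. Uniqueness holds because the
  \<open>chi_dot I\<close> span \<open>scf\<close>.\<close>
lemma (in group) ch_properties:
  assumes "cyclic_group G" "1 < Coset.order G"
  shows linear_on_functions_ch: "linear_on_functions (scf G n) (ch G n)"
    and ch_chi_dot: "I \<subseteq> {1..n - 1} \<Longrightarrow> ch G n (chi_dot G n I) = fundamental_qsym (comp_of n I)"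
proof -
  let ?N = "{1..n - 1}" and ?\<nu> = "of_nat (Coset.order G) :: complex"
  let ?L = "\<lambda>I. fundamental_qsym (comp_of n I)"
  define P where "P \<Phi> \<longleftrightarrow> \<Phi> \<in> extensional (scf G n) \<and>
     (\<forall>f\<in>scf G n. \<forall>g\<in>scf G n. \<Phi> (f + g) = \<Phi> f + \<Phi> g) \<and>
     (\<forall>c. \<forall>f\<in>scf G n. \<Phi> (scale_fun c f) = scale_fun c (\<Phi> f)) \<and>
     (\<forall>I. I \<subseteq> ?N \<longrightarrow> \<Phi> (chi_dot G n I) = ?L I)" for \<Phi>
  have ch: "ch G n = (THE \<Phi>. P \<Phi>)"
    by (simp add: ch_def P_def)
  have \<nu>: "?\<nu> \<noteq> 0" "?\<nu> \<noteq> 1"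
    using assms(2) by auto
  obtain r where r: "\<And>f. f \<in> scf G n \<Longrightarrow> f = (\<Sum>J\<in>Pow ?N. scale_fun (f (r J)) (kappa G n J))"
    and kappa_r: "\<And>J J'. J \<in> Pow ?N \<Longrightarrow> J' \<in> Pow ?N \<Longrightarrow> kappa G n J (r J') = (if J = J' then 1 else 0)"
    by (rule scf_expansion[OF assms(2), of n], rule that) assumption+
  define F where "F f = (\<Sum>J\<in>Pow ?N. scale_fun (f (r J) * (?\<nu> - 1) ^ card J)
      (\<Sum>I\<in>Pow ?N. scale_fun (kappa_coeff ?\<nu> ?N J I) (?L I)))" for f
  have chi_dot_r: "chi_dot G n I (r J) = chi_dot_coeff ?\<nu> ?N I J" if "J \<in> Pow ?N" for I J
  proof -
    have "chi_dot G n I (r J) = (\<Sum>J'\<in>Pow ?N. if J' = J then chi_dot_coeff ?\<nu> ?N I J' else 0)"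
      unfolding chi_dot_expansion[OF assms] using kappa_r that by (intro sum.cong refl) auto
    then show ?thesis
      using that by simp
  qed
  have F_chi_dot: "F (chi_dot G n I) m = ?L I m" if I: "I \<subseteq> ?N" for I m
  proof -
    have "F (chi_dot G n I) m = (\<Sum>J\<in>Pow ?N. \<Sum>I'\<in>Pow ?N.
        chi_dot_coeff ?\<nu> ?N I J * (?\<nu> - 1) ^ card J * kappa_coeff ?\<nu> ?N J I' * ?L I' m)"
      by (simp add: F_def sum_fun_apply scale_fun_def chi_dot_r sum_distrib_left mult_ac)
    also have "\<dots> = (\<Sum>I'\<in>Pow ?N. \<Sum>J\<in>Pow ?N.
        chi_dot_coeff ?\<nu> ?N I J * (?\<nu> - 1) ^ card J * kappa_coeff ?\<nu> ?N J I' * ?L I' m)"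
      by (rule sum.swap)
    also have "\<dots> = (\<Sum>I'\<in>Pow ?N. (if I = I' then 1 else 0) * ?L I' m)"
      using I \<nu> chi_dot_coeff_kappa_coeff_inverse[of ?N I _ ?\<nu>]
      by (intro sum.cong refl) (simp flip: sum_distrib_right)
    also have "\<dots> = (\<Sum>I'\<in>Pow ?N. if I' = I then ?L I' m else 0)"
      by (intro sum.cong refl) auto
    finally show ?thesis
      using I by simp
  qed
  have exists: "P (restrict F (scf G n))"
    unfolding P_def
  proof (intro conjI ballI allI impI)
    fix f g assume fg: "f \<in> scf G n" "g \<in> scf G n"
    then have "f + g \<in> scf G n"
      using subspace_scf complex_functions.subspace_add by blast
    moreover have "F (f + g) = F f + F g"
      by (simp add: F_def fun_eq_iff scale_fun_def sum_fun_apply algebra_simps sum.distrib)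
    ultimately show "restrict F (scf G n) (f + g) = restrict F (scf G n) f + restrict F (scf G n) g"
      using fg by simp
  next
    fix c f assume f: "f \<in> scf G n"
    then have "scale_fun c f \<in> scf G n"
      using subspace_scf complex_functions.subspace_scale by blast
    moreover have "F (scale_fun c f) = scale_fun c (F f)"
      by (simp add: F_def fun_eq_iff scale_fun_def sum_fun_apply sum_distrib_left mult_ac)
    ultimately show "restrict F (scf G n) (scale_fun c f) = scale_fun c (restrict F (scf G n) f)"
      using f by simp
  next
    fix I assume "I \<subseteq> ?N"
    then show "restrict F (scf G n) (chi_dot G n I) = ?L I"
      using F_chi_dot chi_dot_in_scf[OF assms] by auto
  qed simp
  have unique: "\<Phi> = \<Psi>" if "P \<Phi>" "P \<Psi>" for \<Phi> \<Psi>
  proof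
    fix f
    show "\<Phi> f = \<Psi> f"
    proof (cases "f \<in> scf G n")
      case True
      then obtain c where c: "f = (\<Sum>I\<in>Pow ?N. scale_fun (c I) (chi_dot G n I))"
        using scf_spanned_by_chi_dot[OF assms] by blast
      have "\<Theta> f = (\<Sum>I\<in>Pow ?N. scale_fun (c I) (?L I))" if "P \<Theta>" for \<Theta>
      proof -
        have "linear_on_functions (scf G n) \<Theta>"
          using that by (simp add: P_def linear_on_functions_def)
        then have "\<Theta> f = (\<Sum>I\<in>Pow ?N. scale_fun (c I) (\<Theta> (chi_dot G n I)))"
          unfolding c by (rule linear_on_functions_sum[OF subspace_scf _ chi_dot_in_scf[OF assms]])
        then show ?thesis
          using that by (simp add: P_def)
      qed
      then show ?thesis
        using that by simp
    next
      case False
      then show ?thesis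
        using that by (simp add: P_def extensional_def)
    qed
  qed
  have P_ch: "P (ch G n)"
    unfolding ch by (rule theI[of P, OF exists unique[OF _ exists]])
  show "linear_on_functions (scf G n) (ch G n)"
    using P_ch unfolding P_def linear_on_functions_def by blast
  show "ch G n (chi_dot G n I) = ?L I" if "I \<subseteq> {1..n - 1}"
    using P_ch that unfolding P_def by blast
qed

section \<open>Comparison of monomial coefficients\<close>

lemma fundamental_qsym_comp_of:
  assumes "I \<subseteq> {1..n - 1}"
  shows "fundamental_qsym (comp_of n I) m =
    (\<Sum>B\<in>Pow {1..n - 1}. (if I \<subseteq> B then 1 else 0) * monomial_qsym (comp_of n B) m)"
proof -
  have "fundamental_qsym (comp_of n I) m =
    (\<Sum>B\<in>{B \<in> Pow {1..n - 1}. I \<subseteq> B}. monomial_qsym (comp_of n B) m)"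
    unfolding fundamental_qsym_def sum_list_comp_of[OF assms] descent_set_comp_of[OF assms] sum_fun_apply
    by (intro sum.cong) auto
  also have "\<dots> = (\<Sum>B\<in>Pow {1..n - 1}. if I \<subseteq> B then monomial_qsym (comp_of n B) m else 0)"
    by (rule sum.mono_neutral_cong_left) auto
  also have "\<dots> = (\<Sum>B\<in>Pow {1..n - 1}. (if I \<subseteq> B then 1 else 0) * monomial_qsym (comp_of n B) m)"
    by (intro sum.cong refl) simp
  finally show ?thesis .
qed

lemma (in group) qsym_K_expansion:
  assumes "cyclic_group G" "1 < Coset.order G" "is_composition \<alpha>"
  defines "n \<equiv> sum_list \<alpha>" and "J \<equiv> descent_set \<alpha>"
  shows "qsym_K G \<alpha> m = (\<Sum>B\<in>Pow {1..n - 1}.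
    (\<Sum>I\<in>Pow {1..n - 1}. kappa_coeff (of_nat (Coset.order G)) {1..n - 1} J I * (if I \<subseteq> B then 1 else 0)) *
      monomial_qsym (comp_of n B) m)"
proof -
  let ?N = "{1..n - 1}" and ?k = "kappa_coeff (of_nat (Coset.order G)) {1..n - 1} J"
  have J: "J \<subseteq> ?N"
    using descent_set_subset[OF assms(3)] by (simp add: J_def n_def)
  have "(\<lambda>g. kappa G n J g / (of_nat (Coset.order G) - 1) ^ card J) =
      (\<Sum>I\<in>Pow ?N. scale_fun (?k I) (chi_dot G n I))"
    by (rule ext) (simp add: kappa_expansion[OF assms(1,2) J] sum_fun_apply scale_fun_def)
  then have "qsym_K G \<alpha> = ch G n (\<Sum>I\<in>Pow ?N. scale_fun (?k I) (chi_dot G n I))"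
    by (simp add: qsym_K_def n_def J_def)
  also have "\<dots> = (\<Sum>I\<in>Pow ?N. scale_fun (?k I) (ch G n (chi_dot G n I)))"
    by (rule linear_on_functions_sum[OF subspace_scf linear_on_functions_ch[OF assms(1,2)]
        chi_dot_in_scf[OF assms(1,2)]])
  also have "\<dots> = (\<Sum>I\<in>Pow ?N. scale_fun (?k I) (fundamental_qsym (comp_of n I)))"
    by (intro sum.cong refl) (simp only: ch_chi_dot[OF assms(1,2) PowD])
  finally have "qsym_K G \<alpha> m = (\<Sum>I\<in>Pow ?N. ?k I * fundamental_qsym (comp_of n I) m)"
    by (simp add: sum_fun_apply scale_fun_def)
  also have "\<dots> = (\<Sum>I\<in>Pow ?N. \<Sum>B\<in>Pow ?N.
      ?k I * (if I \<subseteq> B then 1 else 0) * monomial_qsym (comp_of n B) m)"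
    by (intro sum.cong refl) (simp only: fundamental_qsym_comp_of[OF PowD] sum_distrib_left mult.assoc)
  also have "\<dots> = (\<Sum>B\<in>Pow ?N. \<Sum>I\<in>Pow ?N.
      ?k I * (if I \<subseteq> B then 1 else 0) * monomial_qsym (comp_of n B) m)"
    by (rule sum.swap)
  also have "\<dots> = (\<Sum>B\<in>Pow ?N. (\<Sum>I\<in>Pow ?N. ?k I * (if I \<subseteq> B then 1 else 0)) *
      monomial_qsym (comp_of n B) m)"
    by (simp only: sum_distrib_right)
  finally show ?thesis .
qed

text \<open>Both sides are sums of monomial functions over the sets \<open>B\<close> of positions that avoid the
  descents of \<open>\<alpha>\<close>, with equal coefficients by \<open>sum_kappa_coeff_subsets\<close>.\<close>
theorem proposition4p5:
  fixes C :: "('a, 'b) monoid_scheme" and \<nu> :: nat and \<alpha> :: "nat list"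
  assumes "group C" and "cyclic_group C" and "Coset.order C = \<nu>" and "1 < \<nu>"
    and "is_composition \<alpha>"
  shows "qsym_D (comp_complement \<alpha>) (- of_nat \<nu>) (of_nat \<nu> - 1) = qsym_K C \<alpha>"
proof
  fix m
  interpret group C by fact
  define n where "n = sum_list \<alpha>"
  let ?N = "{1..n - 1}" and ?J = "descent_set \<alpha>" and ?\<nu> = "of_nat \<nu> :: complex"
  let ?\<alpha>c = "comp_complement \<alpha>"
  let ?c = "\<lambda>B. (- ?\<nu>) powi (int (card B) - int (n - 1)) * (1 - ?\<nu>) ^ (card (?N - ?J) - card B)"
  have J: "?J \<subseteq> ?N"
    using descent_set_subset[OF assms(5)] by (simp add: n_def)
  have sub: "?N - ?J \<subseteq> {1..n - 1}"
    by auto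
  have \<alpha>c: "is_composition ?\<alpha>c" "sum_list ?\<alpha>c = n" "descent_set ?\<alpha>c = ?N - ?J"
    unfolding comp_complement_def n_def[symmetric]
    using is_composition_comp_of[OF sub] sum_list_comp_of[OF sub] descent_set_comp_of[OF sub] by auto
  have "qsym_D ?\<alpha>c (- ?\<nu>) (?\<nu> - 1) m =
      (\<Sum>B\<in>Pow (?N - ?J). ?c B * monomial_qsym (comp_of n B) m)"
    unfolding qsym_D_eq_sum_Pow[OF \<alpha>c(1)] \<alpha>c(2,3) by (simp add: sum_fun_apply scale_fun_def)
  also have "\<dots> = (\<Sum>B\<in>Pow ?N. (if B \<subseteq> ?N - ?J then ?c B else 0) * monomial_qsym (comp_of n B) m)"
    by (rule sum.mono_neutral_cong_left) auto
  also have "\<dots> = (\<Sum>B\<in>Pow ?N.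
      (\<Sum>I\<in>Pow ?N. kappa_coeff ?\<nu> ?N ?J I * (if I \<subseteq> B then 1 else 0)) * monomial_qsym (comp_of n B) m)"
    using sum_kappa_coeff_subsets[OF _ J, of _ ?\<nu>] assms(4) by (intro sum.cong refl) simp
  also have "\<dots> = qsym_K C \<alpha> m"
    using qsym_K_expansion[OF assms(2) _ assms(5), of m] assms(3,4) by (simp add: n_def)
  finally show "qsym_D ?\<alpha>c (- ?\<nu>) (?\<nu> - 1) m = qsym_K C \<alpha> m" .
qed

end
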